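(* Let $m,n,p\ge 2$ and $k\ge3$. Suppose $\mathcal{F}_1,\dots,\mathcal{F}_k$, $\mathcal{G}_1,\dots,\mathcal{G}_k$, $\mathcal{H}_1,\dots,\mathcal{H}_k$ are families of pairwise almost orthogonal symmetric chain decompositions of $Q_m$, $Q_n$, $Q_p$ respectively, such that two of these three families are good and the remaining family is either good or belongs to an odd-dimensional hypercube. Then there exist $k$ pairwise almost orthogonal symmetric chain decompositions $\mathcal{D}_1,\dots,\mathcal{D}_k$ of $Q_{m+n+p}=Q_m\times Q_n\times Q_p$ such that for each $i$ every chain of $\mathcal{D}_i$ is contained in a cuboid $A\times B\times C$ with $A\in\mathcal{F}_i$, $B\in\mathcal{G}_i$, $C\in\mathcal{H}_i$.
   Context: $Q_n$ denotes the Boolean lattice of subsets of $[n]=\{1,\dots,n\}$ under inclusion; products of hypercubes (product order) are identified with the hypercube of the summed dimension. A symmetric chain in $Q_n$ consists of exactly one subset of each size $j,\dots,n-j$ for some $j$; a symmetric chain decomposition (SCD) is a partition into symmetric chains. Two SCDs $\mathcal{F},\mathcal{G}$ of $Q_n$ are almost orthogonal if for all chains $A\in\mathcal{F}$, $B\in\mathcal{G}$, $|A\cap B|\le1$, except when $A$ and $B$ both contain $\varnothing$ and $[n]$, in which case $|A\cap B|=2$. A collection $\{\mathcal{F}^j\}$ of pairwise almost orthogonal SCDs of $Q_n$ is good if either $n$ is even and the $1$-element chains occurring in the different $\mathcal{F}^j$ are pairwise distinct, or $n$ is odd and the graph whose vertex set is the union of all $2$-element chains of all $\mathcal{F}^j$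 and whose edges are these $2$-element chains admits an orientation in which every vertex has out-degree at most $1$. *)

theory Defs
  imports "HOL-Library.Disjoint_Sets"
begin

definition symmetric_chain :: "nat \<Rightarrow> nat set set \<Rightarrow> bool" where
  "symmetric_chain n C \<longleftrightarrow>
     subset.chain (Pow {1..n}) C \<and>
     (\<exists>j. j \<le> n - j \<and> bij_betw card C {j..n - j})"

definition scd :: "nat \<Rightarrow> nat set set set \<Rightarrow> bool" where
  "scd n \<F> \<longleftrightarrow> partition_on (Pow {1..n}) \<F> \<and> (\<forall>C\<in>\<F>. symmetric_chain n C)"

definition almost_orthogonal :: "nat \<Rightarrow> nat set set set \<Rightarrow> nat set set set \<Rightarrow> bool" where
  "almost_orthogonal n \<F> \<G> \<longleftrightarrow>
     (\<forall>A\<in>\<F>. \<forall>B\<in>\<G>.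
        if {{}, {1..n}} \<subseteq> A \<and> {{}, {1..n}} \<subseteq> B
        then card (A \<inter> B) = 2 else card (A \<inter> B) \<le> 1)"

definition almost_orthogonal_scds :: "nat \<Rightarrow> nat \<Rightarrow> (nat \<Rightarrow> nat set set set) \<Rightarrow> bool" where
  "almost_orthogonal_scds n k \<F> \<longleftrightarrow>
     (\<forall>i\<in>{1..k}. scd n (\<F> i)) \<and>
     pairwise (\<lambda>i j. almost_orthogonal n (\<F> i) (\<F> j)) {1..k}"

text \<open>
  Simple graphs are given by their set of edges, each edge being a two-element set of vertices.
\<close>

definition orientation :: "'a set set \<Rightarrow> ('a \<times> 'a) set \<Rightarrow> bool" where
  "orientation E R \<longleftrightarrow>
     (\<forall>(u, v)\<in>R. {u, v} \<in> E) \<and>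
     (\<forall>u v. u \<noteq> v \<longrightarrow> {u, v} \<in> E \<longrightarrow> ((u, v) \<in> R) \<noteq> ((v, u) \<in> R))"

definition out_degree :: "('a \<times> 'a) set \<Rightarrow> 'a \<Rightarrow> nat" where
  "out_degree R u = card (R `` {u})"

definition two_element_chains :: "nat \<Rightarrow> (nat \<Rightarrow> nat set set set) \<Rightarrow> nat set set set" where
  "two_element_chains k \<F> = {C. (\<exists>i\<in>{1..k}. C \<in> \<F> i) \<and> card C = 2}"

definition good :: "nat \<Rightarrow> nat \<Rightarrow> (nat \<Rightarrow> nat set set set) \<Rightarrow> bool" where
  "good n k \<F> \<longleftrightarrow>
     almost_orthogonal_scds n k \<F> \<and>
     (even n \<and>
        (\<forall>i\<in>{1..k}. \<forall>j\<in>{1..k}. i \<noteq> j \<longrightarrow>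
           (\<forall>A\<in>\<F> i. \<forall>B\<in>\<F> j. card A = 1 \<longrightarrow> card B = 1 \<longrightarrow> A \<noteq> B)) \<or>
      odd n \<and>
        (\<exists>R. orientation (two_element_chains k \<F>) R \<and>
             (\<forall>u \<in> \<Union>(two_element_chains k \<F>). out_degree R u \<le> 1)))"

text \<open>
  The identification of \<open>Q\<^sub>m \<times> Q\<^sub>n \<times> Q\<^sub>p\<close> with \<open>Q\<^bsub>m+n+p\<^esub>\<close>: the ground sets of the three
  factors become the blocks \<open>{1..m}\<close>, \<open>{m+1..m+n}\<close> and \<open>{m+n+1..m+n+p}\<close>.
\<close>

definition cube_prod :: "nat \<Rightarrow> nat \<Rightarrow> nat set \<times> nat set \<times> nat set \<Rightarrow> nat set" where
  "cube_prod m n = (\<lambda>(X, Y, Z). X \<union> (+) m ` Y \<union> (+) (m + n) ` Z)"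

definition cuboid ::
  "nat \<Rightarrow> nat \<Rightarrow> nat set set \<Rightarrow> nat set set \<Rightarrow> nat set set \<Rightarrow> nat set set" where
  "cuboid m n A B C = cube_prod m n ` (A \<times> B \<times> C)"

lemma cube_prod_subset_iff:
  assumes "X \<subseteq> {1..m}" "Y \<subseteq> {1..n}" "Z \<subseteq> {1..p}" "X' \<subseteq> {1..m}" "Y' \<subseteq> {1..n}" "Z' \<subseteq> {1..p}"
  shows "cube_prod m n (X, Y, Z) \<subseteq> cube_prod m n (X', Y', Z') \<longleftrightarrow>
    X \<subseteq> X' \<and> Y \<subseteq> Y' \<and> Z \<subseteq> Z'" (is "?L \<longleftrightarrow> ?R")
proof
  assume L: ?L
  have "x \<in> X'" if "x \<in> X" for x
  proof -
    have "x \<in> cube_prod m n (X', Y', Z')" using that L by (auto simp: cube_prod_def)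
    then show ?thesis using that assms by (fastforce simp: cube_prod_def)
  qed
  moreover have "y \<in> Y'" if "y \<in> Y" for y
  proof -
    have "m + y \<in> cube_prod m n (X', Y', Z')" using that L by (auto simp: cube_prod_def)
    then show ?thesis using that assms by (fastforce simp: cube_prod_def)
  qed
  moreover have "z \<in> Z'" if "z \<in> Z" for z
  proof -
    have "m + n + z \<in> cube_prod m n (X', Y', Z')" using that L by (auto simp: cube_prod_def)
    then show ?thesis using that assms by (fastforce simp: cube_prod_def)
  qed
  ultimately show ?R by blast
next
  assume ?R
  then show ?L unfolding cube_prod_def by auto
qed

lemma bij_betw_cube_prod:
  "bij_betw (cube_prod m n) (Pow {1..m} \<times> Pow {1..n} \<times> Pow {1..p}) (Pow {1..m + n + p})"
proof (rule bij_betwI')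
  fix S T
  assume S: "S \<in> Pow {1..m} \<times> Pow {1..n} \<times> Pow {1..p}"
    and T: "T \<in> Pow {1..m} \<times> Pow {1..n} \<times> Pow {1..p}"
  obtain X Y Z where S': "S = (X, Y, Z)" "X \<subseteq> {1..m}" "Y \<subseteq> {1..n}" "Z \<subseteq> {1..p}"
    using S by blast
  obtain X' Y' Z' where T': "T = (X', Y', Z')" "X' \<subseteq> {1..m}" "Y' \<subseteq> {1..n}" "Z' \<subseteq> {1..p}"
    using T by blast
  show "(cube_prod m n S = cube_prod m n T) = (S = T)"
    using cube_prod_subset_iff[OF S'(2-4) T'(2-4)] cube_prod_subset_iff[OF T'(2-4) S'(2-4)]
    unfolding S'(1) T'(1) by blast
next
  fix S
  assume "S \<in> Pow {1..m} \<times> Pow {1..n} \<times> Pow {1..p}"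
  then obtain X Y Z where S: "S = (X, Y, Z)" "X \<subseteq> {1..m}" "Y \<subseteq> {1..n}" "Z \<subseteq> {1..p}"
    by blast
  have "X \<subseteq> {1..m + n + p}" "(+) m ` Y \<subseteq> {1..m + n + p}" "(+) (m + n) ` Z \<subseteq> {1..m + n + p}"
    using S(2-4) by force+
  then show "cube_prod m n S \<in> Pow {1..m + n + p}"
    by (simp add: S(1) cube_prod_def)
next
  fix W
  assume W: "W \<in> Pow {1..m + n + p}"
  define Y where "Y = {y\<in>{1..n}. m + y \<in> W}"
  define Z where "Z = {z\<in>{1..p}. m + n + z \<in> W}"
  have "x \<in> W \<inter> {1..m} \<union> (+) m ` Y \<union> (+) (m + n) ` Z" if x: "x \<in> W" for x
  proof -
    consider "x \<in> {1..m}" | "x - m \<in> {1..n}" "x = m + (x - m)"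
      | "x - (m + n) \<in> {1..p}" "x = m + n + (x - (m + n))"
    proof -
      have "1 \<le> x" "x \<le> m + n + p" using x W by auto
      then consider "x \<le> m" | "m < x" "x \<le> m + n" | "m + n < x" by linarith
      then show thesis using that \<open>1 \<le> x\<close> \<open>x \<le> m + n + p\<close> by cases auto
    qed
    then show ?thesis
    proof cases
      case 1
      then show ?thesis using x by simp
    next
      case 2
      then have "x - m \<in> Y" using x by (simp add: Y_def)
      then show ?thesis using 2 by blast
    next
      case 3
      then have "x - (m + n) \<in> Z" using x by (simp add: Z_def)
      then show ?thesis using 3 by blast
    qed
  qed
  then have "W \<subseteq> W \<inter> {1..m} \<union> (+) m ` Y \<union> (+) (m + n) ` Z"
    by blast
  moreover have "W \<inter> {1..m} \<union> (+) m ` Y \<union> (+) (m + n) ` Z \<subseteq> W"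
    by (auto simp: Y_def Z_def)
  ultimately have "W = cube_prod m n (W \<inter> {1..m}, Y, Z)"
    unfolding cube_prod_def prod.case by (rule subset_antisym)
  moreover have "(W \<inter> {1..m}, Y, Z) \<in> Pow {1..m} \<times> Pow {1..n} \<times> Pow {1..p}"
    by (auto simp: Y_def Z_def)
  ultimately show "\<exists>S \<in> Pow {1..m} \<times> Pow {1..n} \<times> Pow {1..p}. W = cube_prod m n S"
    by blast
qed

end

theory Submission
  imports Defs
begin

text \<open>
  Since \<open>k \<ge> 3\<close>, comparing successors in the \<open>k\<close> decompositions shows that every factor has dimension
  at least 4, so that chains through \<open>\<emptyset>\<close> and the full set (\<^emph>\<open>full\<close> chains) have at least 5 elements. Each
  cuboid \<open>A \<times> B \<times> C\<close> is decomposed separately, as a box of natural numbers. If chains of two different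
  product decompositions share two comparable elements, each of the three coordinates is either
  constant or runs from the bottom to the top of a full chain. If all three run, the pair
  is the one that almost orthogonality allows; every other pair is \<^emph>\<open>bad\<close> and must not be shared.

  Goodness supplies, for each \<open>i\<close>, a designated element in every chain of size at most 2 such that
  the designated elements for different \<open>i\<close> differ: the element of a one-element chain, or the tail of
  an oriented two-element chain. In the remaining family, which may lie in an odd-dimensional cube,
  only one-element chains get a designated element. If a bad pair can occur only at a designated
  value of one of its constant coordinates, then it is not shared by two decompositions.
  Every box has a symmetric chain decomposition with this property: when at least two of its
  sides come from full chains, the exceptions are needed only if some side has length 1.
\<close>

section \<open>Zigzag decompositions of rectangles\<close>

text \<open>
  For \<open>t \<le> y\<close> the chain with index \<open>t\<close> in the \<open>a \<times> b\<close> rectangle rises from \<open>(t, 0)\<close> to height \<open>y - t\<close>,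
  moves right by \<open>a - 1 - y\<close>, rises to height \<open>b - 1 - t\<close> and moves right to the border. What
  remains is a rectangle in the upper left corner, filled with L-shaped chains. The parameter \<open>y\<close>
  controls in which rows and columns a chain runs from border to border. The index of the chain
  through a point is \<open>zz_index\<close>, and \<open>zz_path\<close> parametrizes each chain by rank.
\<close>

definition zz_index :: "nat \<Rightarrow> nat \<Rightarrow> nat \<Rightarrow> nat \<times> nat \<Rightarrow> nat" where
  "zz_index a b y = (\<lambda>(u, v).
     if u + y + 1 < a \<and> y < v then y + 1 + min u (b - 1 - v)
     else min u (min (max (y - v) (u + y + 1 - a)) (b - 1 - v)))"

definition zz_path :: "nat \<Rightarrow> nat \<Rightarrow> nat \<Rightarrow> nat \<Rightarrow> nat \<Rightarrow> nat \<times> nat" where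
  "zz_path a b y t r =
     (if t \<le> y then
        if r \<le> y then (t, r - t)
        else if r < a then (r + t - y, y - t)
        else if r + y + 2 \<le> a + b then (a + t - Suc y, r + y + 1 - (a + t))
        else (r + t + 1 - b, b - 1 - t)
      else if r < b then (t - Suc y, r + y + 1 - t)
      else (r + t - (b + y), b + y - t))"

definition zz_chain :: "nat \<Rightarrow> nat \<Rightarrow> nat \<Rightarrow> nat \<Rightarrow> (nat \<times> nat) set" where
  "zz_chain a b y t = zz_path a b y t ` {t..a + b - 2 - t}"

lemma zz_path_rank:
  assumes "y < a" "y < b" "t < a" "t < b" "t \<le> r" "r + t + 2 \<le> a + b"
  shows "fst (zz_path a b y t r) < a" "snd (zz_path a b y t r) < b"
    "fst (zz_path a b y t r) + snd (zz_path a b y t r) = r"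
  using assms unfolding zz_path_def by (auto split: if_splits)

lemma zz_path_mono:
  assumes "y < a" "y < b" "t < a" "t < b" "t \<le> r" "r \<le> r'" "r' + t + 2 \<le> a + b"
  shows "fst (zz_path a b y t r) \<le> fst (zz_path a b y t r')"
    "snd (zz_path a b y t r) \<le> snd (zz_path a b y t r')"
  using assms unfolding zz_path_def by (auto split: if_splits)

text \<open>On the four segments of a chain with \<open>t \<le> y\<close> the minimum in
  \<open>zz_index\<close> is attained in turn by \<open>u\<close>, \<open>y - v\<close>,
  \<open>u + y + 1 - a\<close> and \<open>b - 1 - v\<close>. The last two cases are the arms of an
  L-shaped chain.\<close>

lemma zz_index_path:
  assumes "y < a" "y < b" "t < a" "t < b" "t \<le> r" "r + t + 2 \<le> a + b"
  shows "zz_index a b y (zz_path a b y t r) = t"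
proof -
  consider "t \<le> y" "r \<le> y" | "t \<le> y" "y < r" "r < a" | "t \<le> y" "y < r" "a \<le> r" "r + y + 2 \<le> a + b"
    | "t \<le> y" "y < r" "a \<le> r" "a + b < r + y + 2" | "y < t" "r < b" | "y < t" "b \<le> r"
    by linarith
  then show ?thesis
  proof cases
    case 1
    then show ?thesis using assms by (auto simp add: zz_path_def zz_index_def)
  next
    case 2
    then show ?thesis using assms by (auto simp add: zz_path_def zz_index_def)
  next
    case 3
    then show ?thesis using assms by (auto simp add: zz_path_def zz_index_def)
  next
    case 4
    then show ?thesis using assms by (auto simp add: zz_path_def zz_index_def)
  next
    case 5
    \<comment> \<open>\<open>s\<close> numbers the L-shaped chains from the left and is the column
      of the rising arm.\<close>
    then obtain s where s: "t = y + 1 + s" by (metis Suc_eq_plus1 Suc_leI less_eqE)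
    then have "zz_path a b y t r = (s, r - s)" using 5 assms by (simp add: zz_path_def)
    moreover have "s + y + 1 < a \<and> y < r - s" "s \<le> b - 1 - (r - s)" using s 5 assms by linarith+
    ultimately show ?thesis using s by (simp add: zz_index_def)
  next
    case 6
    then obtain s where s: "t = y + 1 + s" by (metis Suc_eq_plus1 Suc_leI less_eqE)
    then have "zz_path a b y t r = (r + s + 1 - b, b - 1 - s)" using 6 assms by (simp add: zz_path_def)
    moreover have "r + s + 1 - b + y + 1 < a \<and> y < b - 1 - s" "b - 1 - (b - 1 - s) = s"
      "s \<le> r + s + 1 - b" using s 6 assms by linarith+
    ultimately show ?thesis using s unfolding zz_index_def by (simp only: prod.case if_True simp_thms min_absorb2)
  qed
qed

text \<open>The term attaining the minimum tells on which segment the point lies. In the middle case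
  the larger of \<open>y - v\<close> and \<open>u + y + 1 - a\<close> separates the horizontal
  segment from the second rise.\<close>

lemma zz_path_index:
  assumes "y < a" "y < b" "u < a" "v < b" "t = zz_index a b y (u, v)"
  shows "t < a \<and> t < b \<and> t \<le> u + v \<and> u + v + t + 2 \<le> a + b \<and> zz_path a b y t (u + v) = (u, v)"
proof (cases "u + y + 1 < a \<and> y < v")
  case True
  then have t: "t = y + 1 + min u (b - 1 - v)"
    using assms by (simp add: zz_index_def)
  show ?thesis
  proof (cases "u \<le> b - 1 - v")
    case True
    then show ?thesis using t assms \<open>u + y + 1 < a \<and> y < v\<close> by (auto simp: zz_path_def)
  next
    case False
    then show ?thesis using t assms(1-4) \<open>u + y + 1 < a \<and> y < v\<close> by (auto simp: zz_path_def)
  qed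
next
  case False
  then have t: "t = min u (min (max (y - v) (u + y + 1 - a)) (b - 1 - v))"
    using assms(5) by (simp only: zz_index_def prod.case if_False)
  let ?M = "max (y - v) (u + y + 1 - a)"
  have "t = u \<and> u \<le> M \<and> u \<le> B \<or> t = B \<and> t \<le> u \<and> t \<le> M \<or> t = M \<and> t \<le> u \<and> t \<le> B"
    if "t = min u (min M B)" for M B :: nat
    using that by (auto simp: min_def)
  from this[OF t] consider (left) "t = u" "u \<le> ?M" "u \<le> b - 1 - v" | (right) "t = b - 1 - v" "t \<le> u" "t \<le> ?M"
    | (middle) "t = ?M" "t \<le> u" "t \<le> b - 1 - v"
    by blast
  then show ?thesis
  proof cases
    case left
    show ?thesis
    proof (cases "y - v \<le> u + y + 1 - a")
      case True
      then have "?M = u + y + 1 - a" by (rule max_absorb2)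
      then show ?thesis using assms(1-4) left False True by (auto simp: zz_path_def)
    next
      case ge: False
      then have "?M = y - v" by simp
      then show ?thesis using assms(1-4) left False ge by (auto simp: zz_path_def)
    qed
  next
    case right
    show ?thesis
    proof (cases "y - v \<le> u + y + 1 - a")
      case True
      then have "?M = u + y + 1 - a" by (rule max_absorb2)
      then show ?thesis using assms(1-4) right False True by (auto simp: zz_path_def)
    next
      case ge: False
      then have "?M = y - v" by simp
      then show ?thesis using assms(1-4) right False ge by (auto simp: zz_path_def)
    qed
  next
    case middle
    show ?thesis
    proof (cases "y - v \<le> u + y + 1 - a")
      case True
      then have "?M = u + y + 1 - a" by (rule max_absorb2)
      then have t': "t = u + y + 1 - a" using middle(1) by simp
      show ?thesis
      proof (cases "a \<le> u + y + 1")
        case a: True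
        then have u: "u = a + t - Suc y" using t' assms(1) by linarith
        have "t \<le> y" using t' assms(3) by linarith
        have path: "zz_path a b y t (u + v) = (u, v)"
        proof -
          consider "u + v \<le> y" | "y < u + v" "u + v < a" | "y < u + v" "a \<le> u + v" by linarith
          then show ?thesis
          proof cases
            case 1
            then have "t = u" using u t' True assms(1) a by linarith
            then show ?thesis using 1 \<open>t \<le> y\<close> by (simp add: zz_path_def)
          next
            case 2
            then have "v = y - t" "u + v + t - y = u" using u t' a True assms(1) by linarith+
            then show ?thesis using 2 \<open>t \<le> y\<close> by (simp add: zz_path_def)
          next
            case 3
            have "u + v + y + 2 \<le> a + b" "u + v + y + 1 - (a + t) = v"
              using u t' a middle(3) assms(4) by linarith+
            then show ?thesis using 3 u \<open>t \<le> y\<close> by (simp add: zz_path_def)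
          qed
        qed
        have "t < a" "t < b" "t \<le> u + v" "u + v + t + 2 \<le> a + b"
          using middle(2,3) assms(1-4) \<open>t \<le> y\<close> u by linarith+
        then show ?thesis using path by blast
      next
        case a: False
        \<comment> \<open>Here \<open>u + y + 1 - a\<close> is truncated to 0, so \<open>v\<close>
          is at least \<open>y\<close>; outside the corner this leaves row \<open>y\<close>, on the
          chain of index 0.\<close>
        then have "t = 0" "v = y" using t' True False by linarith+
        then show ?thesis using a assms(1-4) by (auto simp: zz_path_def)
      qed
    next
      case ge: False
      then have "?M = y - v" by simp
      then show ?thesis using assms(1-4) middle False ge by (auto simp: zz_path_def)
    qed
  qed
qed

lemma mem_zz_chain_iff:
  assumes "y < a" "y < b" "t < a" "t < b"
  shows "(u, v) \<in> zz_chain a b y t \<longleftrightarrow> u < a \<and> v < b \<and> zz_index a b y (u, v) = t"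
proof
  assume "(u, v) \<in> zz_chain a b y t"
  then obtain r where r: "t \<le> r" "r + t + 2 \<le> a + b" "(u, v) = zz_path a b y t r"
    using assms by (auto simp: zz_chain_def)
  show "u < a \<and> v < b \<and> zz_index a b y (u, v) = t"
    using zz_path_rank[OF assms r(1,2)] zz_index_path[OF assms r(1,2)] r(3)[symmetric] by simp
next
  assume "u < a \<and> v < b \<and> zz_index a b y (u, v) = t"
  then have "u < a" "v < b" "t = zz_index a b y (u, v)" by auto
  from zz_path_index[OF assms(1,2) this] show "(u, v) \<in> zz_chain a b y t"
    unfolding zz_chain_def by (intro image_eqI[of _ _ "u + v"]) auto
qed

section \<open>Symmetric chain decompositions of ranked orders\<close>

text \<open>Order, rank and total rank are parameters because the notion serves rectangles, boxes,
  triples of sets and sets alike.\<close>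

definition symch :: "('a \<Rightarrow> 'a \<Rightarrow> bool) \<Rightarrow> ('a \<Rightarrow> nat) \<Rightarrow> nat \<Rightarrow> 'a set \<Rightarrow> bool" where
  "symch le rk N K \<longleftrightarrow>
     (\<exists>j f. 2 * j \<le> N \<and> K = f ` {j..N - j} \<and> (\<forall>r\<in>{j..N - j}. rk (f r) = r) \<and>
        (\<forall>r r'. j \<le> r \<longrightarrow> r \<le> r' \<longrightarrow> r' \<le> N - j \<longrightarrow> le (f r) (f r')))"

text \<open>\<open>P\<close> carries a property of the single chains along, so that the absence of
  bad pairs survives gluing and changes of coordinates.\<close>

definition has_scd ::
  "('a \<Rightarrow> 'a \<Rightarrow> bool) \<Rightarrow> ('a \<Rightarrow> nat) \<Rightarrow> nat \<Rightarrow> ('a set \<Rightarrow> bool) \<Rightarrow> 'a set \<Rightarrow> bool" where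
  "has_scd le rk N P G \<longleftrightarrow> (\<exists>\<K>. partition_on G \<K> \<and> (\<forall>K\<in>\<K>. symch le rk N K \<and> P K))"

lemma symch_nonempty: "symch le rk N K \<Longrightarrow> K \<noteq> {}"
  by (auto simp: symch_def)

lemma has_scd_Union:
  assumes "\<And>i. i \<in> I \<Longrightarrow> has_scd le rk N P (G i)" "disjoint_family_on G I"
  shows "has_scd le rk N P (\<Union>i\<in>I. G i)"
proof -
  obtain \<K> where K: "\<And>i. i \<in> I \<Longrightarrow> partition_on (G i) (\<K> i)"
    "\<And>i K. i \<in> I \<Longrightarrow> K \<in> \<K> i \<Longrightarrow> symch le rk N K \<and> P K"
    using assms(1) unfolding has_scd_def by metis
  have "partition_on (\<Union>i\<in>I. G i) (\<Union>i\<in>I. \<K> i)"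
  proof (rule partition_onI)
    show "\<Union>(\<Union>i\<in>I. \<K> i) = (\<Union>i\<in>I. G i)"
      using partition_onD1[OF K(1)] by auto
    show "{} \<notin> (\<Union>i\<in>I. \<K> i)" using K(1) by (auto simp: partition_on_def)
    fix p q assume pq: "p \<in> (\<Union>i\<in>I. \<K> i)" "q \<in> (\<Union>i\<in>I. \<K> i)" "p \<noteq> q"
    then obtain i i' where i: "i \<in> I" "i' \<in> I" "p \<in> \<K> i" "q \<in> \<K> i'" by auto
    show "disjnt p q"
    proof (cases "i = i'")
      case True
      then show ?thesis using K(1)[OF i(1)] i pq(3)
        by (metis partition_onD2 disjointD disjnt_def)
    next
      case False
      then have "G i \<inter> G i' = {}" using assms(2) i by (auto simp: disjoint_family_on_def)
      moreover have "p \<subseteq> G i" "q \<subseteq> G i'"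
        using K(1) i by (auto simp: partition_on_def)
      ultimately show ?thesis by (auto simp: disjnt_def)
    qed
  qed
  then show ?thesis using K(2) unfolding has_scd_def by blast
qed

lemma has_scd_Un:
  assumes "has_scd le rk N P G" "has_scd le rk N P H" "G \<inter> H = {}"
  shows "has_scd le rk N P (G \<union> H)"
proof -
  have "has_scd le rk N P (\<Union>i\<in>UNIV. if i then G else H)"
    by (rule has_scd_Union) (use assms in \<open>auto simp: disjoint_family_on_def\<close>)
  moreover have "(\<Union>i\<in>UNIV. if i then G else H) = G \<union> H" by (auto split: if_splits)
  ultimately show ?thesis by simp
qed

text \<open>A piece that lies \<open>j\<close> ranks above the bottom must lie \<open>j\<close>
  ranks below the top to stay centred; hence the total rank grows by \<open>2 * j\<close>.\<close>

lemma symch_image: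
  assumes "symch le rk N K" "\<And>x. x \<in> K \<Longrightarrow> rk' (g x) = j + rk x" "M = N + 2 * j"
    "\<And>x y. x \<in> K \<Longrightarrow> y \<in> K \<Longrightarrow> le x y \<Longrightarrow> le' (g x) (g y)"
  shows "symch le' rk' M (g ` K)"
proof -
  obtain i f where f: "2 * i \<le> N" "K = f ` {i..N - i}" "\<And>r. r \<in> {i..N - i} \<Longrightarrow> rk (f r) = r"
    "\<And>r r'. i \<le> r \<Longrightarrow> r \<le> r' \<Longrightarrow> r' \<le> N - i \<Longrightarrow> le (f r) (f r')"
    using assms(1) unfolding symch_def by blast
  have "(\<lambda>r. r - j) ` {i + j..M - (i + j)} = {i..N - i}"
  proof (intro equalityI subsetI)
    fix r assume "r \<in> {i..N - i}"
    then show "r \<in> (\<lambda>r. r - j) ` {i + j..M - (i + j)}"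
      by (intro image_eqI[of _ _ "r + j"]) (use assms(3) in auto)
  qed (use assms(3) in auto)
  then have "g ` K = g ` f ` (\<lambda>r. r - j) ` {i + j..M - (i + j)}" by (simp only: f(2))
  then have "g ` K = (\<lambda>r. g (f (r - j))) ` {i + j..M - (i + j)}" by (simp only: image_image)
  moreover have "rk' (g (f (r - j))) = r" if "r \<in> {i + j..M - (i + j)}" for r
  proof -
    have "r - j \<in> {i..N - i}" using that assms(3) by auto
    then show ?thesis using f(2,3) assms(2)[of "f (r - j)"] that by auto
  qed
  moreover have "le' (g (f (r - j))) (g (f (r' - j)))"
    if "i + j \<le> r" "r \<le> r'" "r' \<le> M - (i + j)" for r r'
  proof -
    have "r - j \<in> {i..N - i}" "r' - j \<in> {i..N - i}" using that assms(3) by auto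
    then show ?thesis using that assms(3) f(2) by (intro assms(4) f(4)) auto
  qed
  moreover have "2 * (i + j) \<le> M" using f(1) assms(3) by simp
  ultimately show ?thesis unfolding symch_def by blast
qed

lemma has_scd_image:
  assumes "has_scd le rk N P G" "inj_on g G" "\<And>x. x \<in> G \<Longrightarrow> rk' (g x) = j + rk x" "M = N + 2 * j"
    "\<And>x y. x \<in> G \<Longrightarrow> y \<in> G \<Longrightarrow> le x y \<Longrightarrow> le' (g x) (g y)"
    "\<And>K. K \<subseteq> G \<Longrightarrow> P K \<Longrightarrow> P' (g ` K)"
  shows "has_scd le' rk' M P' (g ` G)"
proof -
  obtain \<K> where K: "partition_on G \<K>" "\<And>K. K \<in> \<K> \<Longrightarrow> symch le rk N K \<and> P K"
    using assms(1) unfolding has_scd_def by blast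
  have sub: "K \<subseteq> G" if "K \<in> \<K>" for K using K(1) that by (auto simp: partition_on_def)
  have "partition_on (g ` G) ((`) g ` \<K>)"
    using partition_on_inj_image[OF K(1) assms(2)] partition_onD3[OF K(1)]
    by (smt (verit) Diff_empty Diff_insert0 image_iff image_is_empty)
  moreover have "symch le' rk' M (g ` K) \<and> P' (g ` K)" if "K \<in> \<K>" for K
    using symch_image[where g = g and K = K and le = le and le' = le' and rk = rk and rk' = rk' and N = N and M = M and j = j]
      K(2)[OF that] sub[OF that] assms(3-6) by (meson subsetD)
  ultimately show ?thesis unfolding has_scd_def by blast
qed

lemma has_scd_rectangle:
  assumes y: "y < a" "y < b"
  shows "has_scd (\<lambda>p q. fst p \<le> fst q \<and> snd p \<le> snd q) (\<lambda>p. fst p + snd p) (a + b - 2)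
    (\<lambda>K. \<exists>t. t < a \<and> t < b \<and> K = zz_chain a b y t) ({..<a} \<times> {..<b})"
proof -
  let ?T = "{..<min a b}"
  have ch: "symch (\<lambda>p q. fst p \<le> fst q \<and> snd p \<le> snd q) (\<lambda>p. fst p + snd p) (a + b - 2)
      (zz_chain a b y t)" if "t < a" "t < b" for t
    unfolding symch_def
  proof (intro exI conjI ballI allI impI)
    show "2 * t \<le> a + b - 2" using that by linarith
    show "zz_chain a b y t = zz_path a b y t ` {t..a + b - 2 - t}" by (simp add: zz_chain_def)
  qed (use zz_path_rank[OF y that] zz_path_mono[OF y that] that in auto)
  have "partition_on ({..<a} \<times> {..<b}) (zz_chain a b y ` ?T)"
  proof (rule partition_onI)
    show "\<Union> (zz_chain a b y ` ?T) = {..<a} \<times> {..<b}"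
    proof (intro equalityI subsetI)
      fix p assume "p \<in> \<Union> (zz_chain a b y ` ?T)"
      then obtain t where "t < a" "t < b" "p \<in> zz_chain a b y t" by auto
      then show "p \<in> {..<a} \<times> {..<b}"
        using mem_zz_chain_iff[OF y, of t "fst p" "snd p"] by (simp add: mem_Times_iff)
    next
      fix p assume p: "p \<in> {..<a} \<times> {..<b}"
      define t where "t = zz_index a b y p"
      have "t < a" "t < b" using zz_path_index[OF y, of "fst p" "snd p" t] p t_def by auto
      moreover have "p \<in> zz_chain a b y t"
        using mem_zz_chain_iff[OF y calculation, of "fst p" "snd p"] p t_def by auto
      ultimately show "p \<in> \<Union> (zz_chain a b y ` ?T)" by auto
    qed
    show "{} \<notin> zz_chain a b y ` ?T"
    proof
      assume "{} \<in> zz_chain a b y ` ?T"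
      then obtain t where "t < a" "t < b" "zz_chain a b y t = {}" by auto
      then show False using symch_nonempty[OF ch] by blast
    qed
    fix p q assume pq: "p \<in> zz_chain a b y ` ?T" "q \<in> zz_chain a b y ` ?T" "p \<noteq> q"
    obtain t where t: "t < a" "t < b" "p = zz_chain a b y t" using pq(1) by auto
    obtain t' where t': "t' < a" "t' < b" "q = zz_chain a b y t'" using pq(2) by auto
    have "t \<noteq> t'" using pq(3) t(3) t'(3) by auto
    then show "disjnt p q"
      using t(3) t'(3) mem_zz_chain_iff[OF y t(1,2)] mem_zz_chain_iff[OF y t'(1,2)]
      by (auto simp: disjnt_def)
  qed
  then show ?thesis unfolding has_scd_def using ch by (intro exI[of _ "zz_chain a b y ` ?T"]) auto
qed

section \<open>Lifting rectangles to boxes\<close>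

definition le3 :: "'a::ord \<times> 'b::ord \<times> 'c::ord \<Rightarrow> 'a \<times> 'b \<times> 'c \<Rightarrow> bool" where
  "le3 = (\<lambda>(x, y, z) (x', y', z'). x \<le> x' \<and> y \<le> y' \<and> z \<le> z')"

definition rk3 :: "nat \<times> nat \<times> nat \<Rightarrow> nat" where
  "rk3 = (\<lambda>(x, y, z). x + y + z)"

text \<open>
  The rectangle spanned by a zigzag chain and the third side is decomposed again, with the third
  side as the first coordinate.
\<close>

definition lift_chain :: "nat \<Rightarrow> nat \<Rightarrow> nat \<Rightarrow> nat \<Rightarrow> nat \<Rightarrow> nat \<Rightarrow> nat \<Rightarrow> (nat \<times> nat \<times> nat) set" where
  "lift_chain a b c y t y' s = {(u, v, w). (u, v) \<in> zz_chain a b y t \<and>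
     (w, u + v - t) \<in> zz_chain c (a + b - 1 - 2 * t) y' s}"

text \<open>A chain times a side is again a rectangle, whose decomposition is transported. Its
  lowest point has rank \<open>t\<close>, which is the rank shift.\<close>

lemma has_scd_chain_times:
  assumes y: "y < a" "y < b" and t: "t < a" "t < b" and y': "y' < c" "y' + 2 * t + 1 < a + b"
  shows "has_scd le3 rk3 (a + b + c - 3)
    (\<lambda>K. \<exists>s. s < c \<and> s + 2 * t + 1 < a + b \<and> K = lift_chain a b c y t y' s)
    {(u, v, w). (u, v) \<in> zz_chain a b y t \<and> w < c}"
proof -
  \<comment> \<open>The chain has one element of each rank from \<open>t\<close> to
    \<open>a + b - 2 - t\<close>, hence \<open>l\<close> elements; \<open>i\<close> counts them from
    0.\<close>
  define l where "l = a + b - 1 - 2 * t"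
  have y'l: "y' < l" using y' by (simp add: l_def)
  define g where "g = (\<lambda>(w, i). (fst (zz_path a b y t (t + i)), snd (zz_path a b y t (t + i)), w :: nat))"
  have rank: "fst (zz_path a b y t (t + i)) + snd (zz_path a b y t (t + i)) = t + i" if "i < l" for i
    using zz_path_rank(3)[OF y t, of "t + i"] that by (auto simp: l_def)
  have mem: "(u, v) \<in> zz_chain a b y t \<longleftrightarrow> (\<exists>i<l. (u, v) = zz_path a b y t (t + i))" for u v
  proof
    assume "(u, v) \<in> zz_chain a b y t"
    then obtain r where r: "t \<le> r" "r \<le> a + b - 2 - t" "(u, v) = zz_path a b y t r"
      by (auto simp: zz_chain_def)
    then show "\<exists>i<l. (u, v) = zz_path a b y t (t + i)"
      using t by (intro exI[of _ "r - t"]) (auto simp: l_def)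
  next
    assume "\<exists>i<l. (u, v) = zz_path a b y t (t + i)"
    then show "(u, v) \<in> zz_chain a b y t" by (auto simp: zz_chain_def l_def)
  qed
  \<comment> \<open>The rank recovers the place of \<open>(u, v)\<close> in its chain as
    \<open>u + v - t\<close>; this yields the coordinate form used in
    \<open>lift_chain\<close>.\<close>
  have im: "g ` X = {(u, v, w). (u, v) \<in> zz_chain a b y t \<and> (w, u + v - t) \<in> X}"
    if "X \<subseteq> {..<c} \<times> {..<l}" for X
  proof (intro equalityI subsetI)
    fix p assume "p \<in> g ` X"
    then obtain w i where "(w, i) \<in> X" "p = g (w, i)" by auto
    moreover have "i < l" using calculation that by auto
    ultimately show "p \<in> {(u, v, w). (u, v) \<in> zz_chain a b y t \<and> (w, u + v - t) \<in> X}"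
      using rank[of i] mem[of "fst (zz_path a b y t (t + i))" "snd (zz_path a b y t (t + i))"]
      by (auto simp: g_def)
  next
    fix p assume "p \<in> {(u, v, w). (u, v) \<in> zz_chain a b y t \<and> (w, u + v - t) \<in> X}"
    then obtain u v w where p: "p = (u, v, w)" "(u, v) \<in> zz_chain a b y t" "(w, u + v - t) \<in> X"
      by auto
    obtain i where i: "i < l" "zz_path a b y t (t + i) = (u, v)" using p(2) mem by metis
    then have "u + v - t = i" using rank[of i] by auto
    then show "p \<in> g ` X" using p i(2) by (intro image_eqI[of _ _ "(w, i)"]) (auto simp: g_def)
  qed
  have "has_scd le3 rk3 (a + b + c - 3)
      (\<lambda>K. \<exists>s. s < c \<and> s + 2 * t + 1 < a + b \<and> K = lift_chain a b c y t y' s) (g ` ({..<c} \<times> {..<l}))"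
  proof (rule has_scd_image[OF has_scd_rectangle[OF y'(1) y'l]])
    show "inj_on g ({..<c} \<times> {..<l})"
      by (rule inj_onI) (use rank in \<open>auto simp: g_def; metis add_left_cancel\<close>)
    show "rk3 (g x) = t + (fst x + snd x)" if "x \<in> {..<c} \<times> {..<l}" for x
      using that rank[of "snd x"] by (auto simp: g_def rk3_def)
    show "a + b + c - 3 = c + l - 2 + 2 * t" using t y' by (simp add: l_def)
    show "le3 (g p) (g q)" if "p \<in> {..<c} \<times> {..<l}" "q \<in> {..<c} \<times> {..<l}"
      "fst p \<le> fst q \<and> snd p \<le> snd q" for p q
      using that zz_path_mono[OF y t, of "t + snd p" "t + snd q"] by (auto simp: g_def le3_def l_def)
    fix K assume K: "K \<subseteq> {..<c} \<times> {..<l}" "\<exists>s. s < c \<and> s < l \<and> K = zz_chain c l y' s"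
    then obtain s where s: "s < c" "s < l" "K = zz_chain c l y' s" by blast
    then show "\<exists>s. s < c \<and> s + 2 * t + 1 < a + b \<and> g ` K = lift_chain a b c y t y' s"
      using im[OF K(1)] by (intro exI[of _ s]) (auto simp: lift_chain_def l_def)
  qed
  also have "g ` ({..<c} \<times> {..<l}) = {(u, v, w). (u, v) \<in> zz_chain a b y t \<and> w < c}"
    unfolding im[OF order_refl] using mem rank by (auto; metis add_diff_cancel_left' fst_conv snd_conv)
  finally show ?thesis .
qed

section \<open>Decompositions of boxes\<close>

lemma has_scd_mono:
  assumes "has_scd le rk N P G" "\<And>K. P K \<Longrightarrow> Q K"
  shows "has_scd le rk N Q G"
  using assms unfolding has_scd_def by blast

text \<open>The second parameter may vary with the chain of the first rectangle;
  \<open>box_scd_tight_flat\<close> relies on this.\<close>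

lemma has_scd_box:
  assumes y: "y < a" "y < b" and y': "\<And>t. t < a \<Longrightarrow> t < b \<Longrightarrow> y' t < c \<and> y' t + 2 * t + 1 < a + b"
  shows "has_scd le3 rk3 (a + b + c - 3)
    (\<lambda>K. \<exists>t s. t < a \<and> t < b \<and> s < c \<and> s + 2 * t + 1 < a + b \<and> K = lift_chain a b c y t (y' t) s)
    ({..<a} \<times> {..<b} \<times> {..<c})"
proof -
  let ?G = "\<lambda>t. {(u, v, w). (u, v) \<in> zz_chain a b y t \<and> w < c}"
  have "has_scd le3 rk3 (a + b + c - 3)
      (\<lambda>K. \<exists>t s. t < a \<and> t < b \<and> s < c \<and> s + 2 * t + 1 < a + b \<and> K = lift_chain a b c y t (y' t) s)
      (\<Union>t\<in>{..<min a b}. ?G t)"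
  proof (rule has_scd_Union)
    fix t assume "t \<in> {..<min a b}"
    then have t: "t < a" "t < b" by auto
    show "has_scd le3 rk3 (a + b + c - 3)
      (\<lambda>K. \<exists>t s. t < a \<and> t < b \<and> s < c \<and> s + 2 * t + 1 < a + b \<and> K = lift_chain a b c y t (y' t) s)
      (?G t)"
      by (rule has_scd_mono[OF has_scd_chain_times[OF y t conjunct1[OF y'[OF t]] conjunct2[OF y'[OF t]]]])
        (use t in blast)
  next
    show "disjoint_family_on ?G {..<min a b}"
      unfolding disjoint_family_on_def
    proof (intro ballI impI)
      fix t t' assume "t \<in> {..<min a b}" "t' \<in> {..<min a b}" "t \<noteq> t'"
      then show "?G t \<inter> ?G t' = {}" using mem_zz_chain_iff[OF y] by auto
    qed
  qed
  also have "(\<Union>t\<in>{..<min a b}. ?G t) = {..<a} \<times> {..<b} \<times> {..<c}"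
  proof (intro equalityI subsetI)
    fix p assume "p \<in> (\<Union>t\<in>{..<min a b}. ?G t)"
    then obtain t u v w where "t < a" "t < b" "p = (u, v, w)" "(u, v) \<in> zz_chain a b y t" "w < c" by auto
    then show "p \<in> {..<a} \<times> {..<b} \<times> {..<c}" using mem_zz_chain_iff[OF y] by simp
  next
    fix p assume "p \<in> {..<a} \<times> {..<b} \<times> {..<c}"
    then obtain u v w where p: "p = (u, v, w)" "u < a" "v < b" "w < c" by auto
    define t where "t = zz_index a b y (u, v)"
    have t: "t < a" "t < b" using zz_path_index[OF y p(2,3) t_def] by auto
    then have "(u, v) \<in> zz_chain a b y t" using mem_zz_chain_iff[OF y t] p t_def by simp
    then show "p \<in> (\<Union>t\<in>{..<min a b}. ?G t)" using t p by auto
  qed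
  finally show ?thesis .
qed

section \<open>Runs from border to border\<close>

text \<open>Opposite borders get different indices. The left column has index 0 in rows 0 and 1 and
  index 2 above; the right column has index 1, except 0 in the top row. Bottom and top row are
  compared in the same way.\<close>

lemma zz_chain_one_no_run:
  assumes "3 \<le> a" "3 \<le> b" "t < a" "t < b"
  shows "(0, v) \<in> zz_chain a b 1 t \<Longrightarrow> (a - 1, v) \<notin> zz_chain a b 1 t"
    "(u, 0) \<in> zz_chain a b 1 t \<Longrightarrow> (u, b - 1) \<notin> zz_chain a b 1 t"
proof -
  have y: "1 < a" "1 < b" using assms by auto
  note m = mem_zz_chain_iff[OF y assms(3,4)]
  have "zz_index a b 1 (0, v) = (if 1 < v then 2 else 0)" using assms by (simp add: zz_index_def)
  moreover have "zz_index a b 1 (a - 1, v) = (if v + 1 < b then 1 else 0)" using assms by (simp add: zz_index_def)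
  ultimately show "(0, v) \<in> zz_chain a b 1 t \<Longrightarrow> (a - 1, v) \<notin> zz_chain a b 1 t"
    using m assms by (auto split: if_splits)
  have "u < a \<Longrightarrow> zz_index a b 1 (u, 0) = min u 1" using assms by (auto simp add: zz_index_def)
  moreover have "zz_index a b 1 (u, b - 1) = (if u + 2 < a then 2 else 0)" using assms by (auto simp add: zz_index_def)
  ultimately show "(u, 0) \<in> zz_chain a b 1 t \<Longrightarrow> (u, b - 1) \<notin> zz_chain a b 1 t"
    using m assms by (auto split: if_splits)
qed

text \<open>The last two claims stop at \<open>b - 2\<close> because in
  \<open>box_scd_tight_flat\<close> the second side is a chain with one element more than the side
  whose top matters.\<close>

lemma zz_chain_two_no_run:
  assumes "5 \<le> a" "6 \<le> b" "t < a" "t < b"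
  shows "(0, v) \<in> zz_chain a b 2 t \<Longrightarrow> (a - 1, v) \<notin> zz_chain a b 2 t"
    "(u, 0) \<in> zz_chain a b 2 t \<Longrightarrow> (u, b - 2) \<notin> zz_chain a b 2 t"
    "(0, 0) \<in> zz_chain a b 2 t \<Longrightarrow> (a - 1, b - 2) \<notin> zz_chain a b 2 t"
proof -
  have y: "2 < a" "2 < b" using assms by auto
  note m = mem_zz_chain_iff[OF y assms(3,4)]
  have 1: "zz_index a b 2 (0, v) = (if 2 < v then 3 else 0)" for v using assms by (simp add: zz_index_def)
  have 2: "zz_index a b 2 (a - 1, v) = min 2 (b - 1 - v)" for v
    using assms by (cases "v \<le> 2") (auto simp add: zz_index_def)
  show "(0, v) \<in> zz_chain a b 2 t \<Longrightarrow> (a - 1, v) \<notin> zz_chain a b 2 t"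
    using m assms 1[of v] 2[of v] by (simp split: if_splits) linarith?
  show "(0, 0) \<in> zz_chain a b 2 t \<Longrightarrow> (a - 1, b - 2) \<notin> zz_chain a b 2 t"
    using m assms 1[of 0] 2[of "b - 2"] by simp
  have "u < a \<Longrightarrow> zz_index a b 2 (u, 0) = min u 2" using assms by (auto simp add: zz_index_def)
  moreover have "zz_index a b 2 (u, b - 2) = (if u + 3 < a then 3 + min u 1 else if u + 3 = a then 0 else 1)"
    using assms by (auto simp add: zz_index_def)
  ultimately show "(u, 0) \<in> zz_chain a b 2 t \<Longrightarrow> (u, b - 2) \<notin> zz_chain a b 2 t"
    using m assms by (auto split: if_splits)
qed

text \<open>The parameter moves the run to a chosen row: with two rows, the chain of index 0 crosses
  the bottom row before rising if \<open>d = 0\<close>, and rises first if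
  \<open>d = 1\<close>.\<close>

lemma zz_chain_thin_run:
  assumes "5 \<le> a" "d < b" "b \<le> 2" "t < a" "t < b"
  shows "(0, v) \<in> zz_chain a b d t \<Longrightarrow> (a - 1, v) \<in> zz_chain a b d t \<Longrightarrow> v = d"
proof -
  have y: "d < a" using assms by auto
  note m = mem_zz_chain_iff[OF y assms(2,4,5)]
  assume v: "(0, v) \<in> zz_chain a b d t" "(a - 1, v) \<in> zz_chain a b d t"
  have "v < b" using v(1) m by simp
  consider "b = 1" | "b = 2" "d = 0" | "b = 2" "d = 1" using assms by linarith
  then show "v = d" using v \<open>v < b\<close> assms unfolding m by cases (auto simp: zz_index_def split: if_splits)
qed

text \<open>
  In dimension at least 4 a full chain has at least 5 elements, so it suffices to control the
  bottom-to-top pairs along all sides of length at least 5, full or not.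
\<close>

definition jump :: "nat \<Rightarrow> nat \<Rightarrow> nat \<Rightarrow> bool" where
  "jump a u u' \<longleftrightarrow> 5 \<le> a \<and> u = 0 \<and> u' = a - 1"

text \<open>Of the patterns in which every coordinate is constant or jumps, two are left out: all
  constant, which is a single point, and all jumping, which is the pair that almost orthogonality
  allows.\<close>

definition tight :: "nat \<Rightarrow> nat \<Rightarrow> nat \<Rightarrow> (nat \<times> nat \<times> nat) set \<Rightarrow> bool" where
  "tight a b c K \<longleftrightarrow> (\<forall>u v w u' v' w'. (u, v, w) \<in> K \<longrightarrow> (u', v', w') \<in> K \<longrightarrow>
     \<not> (jump a u u' \<and> v = v' \<and> w = w') \<and> \<not> (u = u' \<and> jump b v v' \<and> w = w') \<and>
     \<not> (u = u' \<and> v = v' \<and> jump c w w') \<and> \<not> (jump a u u' \<and> jump b v v' \<and> w = w') \<and>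
     \<not> (jump a u u' \<and> v = v' \<and> jump c w w') \<and> \<not> (u = u' \<and> jump b v v' \<and> jump c w w'))"

section \<open>Permuting sides and the tight constructions\<close>

definition box_scd :: "nat \<Rightarrow> nat \<Rightarrow> nat \<Rightarrow> ((nat \<times> nat \<times> nat) set \<Rightarrow> bool) \<Rightarrow> bool" where
  "box_scd a b c P \<longleftrightarrow> has_scd le3 rk3 (a + b + c - 3) P ({..<a} \<times> {..<b} \<times> {..<c})"

lemma box_scd_swap23:
  assumes "box_scd a c b (\<lambda>K. Q ((\<lambda>(u, w, v). (u, v, w)) ` K))"
  shows "box_scd a b c Q"
proof -
  let ?g = "\<lambda>(u :: nat, w :: nat, v :: nat). (u, v, w)"
  have "has_scd le3 rk3 (a + b + c - 3) Q (?g ` ({..<a} \<times> {..<c} \<times> {..<b}))"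
    by (rule has_scd_image[OF assms(1)[unfolded box_scd_def], where j = 0])
      (auto simp: inj_on_def le3_def rk3_def)
  moreover have "?g ` ({..<a} \<times> {..<c} \<times> {..<b}) = {..<a} \<times> {..<b} \<times> {..<c}"
    by (auto simp: image_iff)
  ultimately show ?thesis unfolding box_scd_def by simp
qed

lemma box_scd_swap12:
  assumes "box_scd b a c (\<lambda>K. Q ((\<lambda>(v, u, w). (u, v, w)) ` K))"
  shows "box_scd a b c Q"
proof -
  let ?g = "\<lambda>(v :: nat, u :: nat, w :: nat). (u, v, w)"
  have "has_scd le3 rk3 (a + b + c - 3) Q (?g ` ({..<b} \<times> {..<a} \<times> {..<c}))"
    by (rule has_scd_image[OF assms(1)[unfolded box_scd_def], where j = 0])
      (auto simp: inj_on_def le3_def rk3_def)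
  moreover have "?g ` ({..<b} \<times> {..<a} \<times> {..<c}) = {..<a} \<times> {..<b} \<times> {..<c}"
    by (auto simp: image_iff)
  ultimately show ?thesis unfolding box_scd_def by simp
qed

lemma swap23_iff: "(u, v, w) \<in> (\<lambda>(u, w, v). (u, v, w)) ` K \<longleftrightarrow> (u, w, v) \<in> K"
  by force

lemma swap12_iff: "(u, v, w) \<in> (\<lambda>(v, u, w). (u, v, w)) ` K \<longleftrightarrow> (v, u, w) \<in> K"
  by force

lemma tight_swap23: "tight a c b K \<Longrightarrow> tight a b c ((\<lambda>(u, w, v). (u, v, w)) ` K)"
  unfolding tight_def swap12_iff swap23_iff by blast

lemma tight_swap12: "tight b a c K \<Longrightarrow> tight a b c ((\<lambda>(v, u, w). (u, v, w)) ` K)"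
  unfolding tight_def swap12_iff swap23_iff by blast

lemma lift_chain_iff:
  "(u, v, w) \<in> lift_chain a b c y t y' s \<longleftrightarrow>
     (u, v) \<in> zz_chain a b y t \<and> (w, u + v - t) \<in> zz_chain c (a + b - 1 - 2 * t) y' s"
  by (simp add: lift_chain_def)

text \<open>This serves the cases where two coordinates alone exclude the bad pairs. Any filling
  along the third side then works, and parameter 0 is taken.\<close>

lemma box_scd_lift:
  assumes "y < a" "y < b" "0 < c"
    "\<And>K t. t < a \<Longrightarrow> t < b \<Longrightarrow> (\<And>u v w. (u, v, w) \<in> K \<Longrightarrow> (u, v) \<in> zz_chain a b y t \<and> w < c) \<Longrightarrow> P K"
  shows "box_scd a b c P"
  unfolding box_scd_def
proof (rule has_scd_mono[OF has_scd_box[where y' = "\<lambda>_. 0", OF assms(1,2)]])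
  show "0 < c \<and> 0 + 2 * t + 1 < a + b" if "t < a" "t < b" for t using that assms(3) by simp
  fix K assume "\<exists>t s. t < a \<and> t < b \<and> s < c \<and> s + 2 * t + 1 < a + b \<and> K = lift_chain a b c y t 0 s"
  then obtain t s where ts: "t < a" "t < b" "s < c" "s + 2 * t + 1 < a + b" "K = lift_chain a b c y t 0 s"
    by blast
  have "0 < a + b - 1 - 2 * t" "s < a + b - 1 - 2 * t" using ts by auto
  note m = mem_zz_chain_iff[OF assms(3) this(1) ts(3) this(2)]
  show "P K"
    by (rule assms(4)[OF ts(1,2)]) (use ts(5) m lift_chain_iff in auto)
qed

text \<open>
  The first and third side give two chains with \<open>a + 1\<close> and \<open>a - 1\<close> elements. The longer one
  contains the pair \<open>0, a - 1\<close> of the first side, as its first and its last but one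
  element; this is why it needs the parameter 2.
\<close>

lemma box_scd_tight_flat:
  assumes "5 \<le> a" "5 \<le> b"
  shows "box_scd a b 2 (tight a b 2)"
proof (rule box_scd_swap23)
  have y: "0 < a" "0 < (2 :: nat)" using assms by auto
  let ?y = "\<lambda>t :: nat. if t = 0 then 2 else 1 :: nat"
  show "box_scd a 2 b (\<lambda>K. tight a b 2 ((\<lambda>(u, w, v). (u, v, w)) ` K))"
    unfolding box_scd_def
  proof (rule has_scd_mono[OF has_scd_box[where y' = ?y, OF y]])
    show "?y t < b \<and> ?y t + 2 * t + 1 < a + 2" if "t < a" "t < 2" for t using that assms by auto
    fix K assume "\<exists>t s. t < a \<and> t < 2 \<and> s < b \<and> s + 2 * t + 1 < a + 2 \<and> K = lift_chain a 2 b 0 t (?y t) s"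
    then obtain t s where ts: "t < a" "t < 2" "s < b" "s + 2 * t + 1 < a + 2"
      "K = lift_chain a 2 b 0 t (?y t) s" by blast
    \<comment> \<open>The chain of index 0 follows the bottom row and steps up in the last column;
      index 1 is the rest of the upper row.\<close>
    have ix: "zz_index a 2 0 (u, w) = (if u + 1 < a \<and> w = 1 then 1 else 0)" if "u < a" "w < 2" for u w
      using that assms by (auto simp: zz_index_def)
    have mem: "u < a \<and> w < 2 \<and> (u + 1 < a \<and> w = 1 \<longleftrightarrow> t = 1) \<and>
        (v, u + w - t) \<in> zz_chain b (a + 1 - 2 * t) (?y t) s" if "(u, w, v) \<in> K" for u v w
    proof -
      have z: "(u, w) \<in> zz_chain a 2 0 t" "(v, u + w - t) \<in> zz_chain b (a + 1 - 2 * t) (?y t) s"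
        using that ts(5) by (auto simp: lift_chain_iff)
      then show ?thesis using mem_zz_chain_iff[OF y ts(1,2), of u w] ix[of u w] ts(2) by (auto split: if_splits)
    qed
    consider "t = 0" | "t = 1" using ts(2) by linarith
    then have "tight a 2 b K"
    proof cases
      case 1
      have m: "u < a \<and> w < 2 \<and> (u + 1 < a \<longrightarrow> w = 0) \<and> (v, u + w) \<in> zz_chain b (a + 1) 2 s"
        if "(u, w, v) \<in> K" for u v w using mem[OF that] 1 by auto
      have s: "s < b" "s < a + 1" "6 \<le> a + 1" using ts 1 assms by auto
      note no = zz_chain_two_no_run[OF assms(2) s(3,1,2)]
      show ?thesis unfolding tight_def
      proof (intro allI impI)
        fix u w v u' w' v' assume "(u, w, v) \<in> K" "(u', w', v') \<in> K"
        note m1 = m[OF this(1)] and m2 = m[OF this(2)]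
        \<comment> \<open>A jump of the first side with \<open>w\<close> fixed stays in the bottom
          row, so it joins the places 0 and \<open>a - 1\<close> of the long chain.\<close>
        have A: "u = 0 \<Longrightarrow> u' = a - 1 \<Longrightarrow> w = w' \<Longrightarrow> w = 0" using m1 assms by auto
        have B: "a + 1 - 2 = a - 1" by simp
        show "\<not> (jump a u u' \<and> w = w' \<and> v = v') \<and> \<not> (u = u' \<and> jump 2 w w' \<and> v = v') \<and>
          \<not> (u = u' \<and> w = w' \<and> jump b v v') \<and> \<not> (jump a u u' \<and> jump 2 w w' \<and> v = v') \<and>
          \<not> (jump a u u' \<and> w = w' \<and> jump b v v') \<and> \<not> (u = u' \<and> jump 2 w w' \<and> jump b v v')"
          using m1 m2 A no(1)[of "u + w"] no(2)[of v] no(3) unfolding B jump_def by auto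
      qed
    next
      case 2
      have m: "u + 1 < a \<and> w = 1 \<and> (v, u) \<in> zz_chain b (a - 1) 1 s"
        if "(u, w, v) \<in> K" for u v w using mem[OF that] 2 by auto
      have s: "s < b" "s < a - 1" "3 \<le> a - 1" "3 \<le> b" using ts 2 assms by auto
      \<comment> \<open>The short chain ends at \<open>u = a - 2\<close>, so only jumps of the side
        of length \<open>b\<close> remain to be excluded.\<close>
      note no = zz_chain_one_no_run[OF s(4,3,1,2)]
      show ?thesis unfolding tight_def
      proof (intro allI impI)
        fix u w v u' w' v' assume "(u, w, v) \<in> K" "(u', w', v') \<in> K"
        note m1 = m[OF this(1)] and m2 = m[OF this(2)]
        show "\<not> (jump a u u' \<and> w = w' \<and> v = v') \<and> \<not> (u = u' \<and> jump 2 w w' \<and> v = v') \<and>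
          \<not> (u = u' \<and> w = w' \<and> jump b v v') \<and> \<not> (jump a u u' \<and> jump 2 w w' \<and> v = v') \<and>
          \<not> (jump a u u' \<and> w = w' \<and> jump b v v') \<and> \<not> (u = u' \<and> jump 2 w w' \<and> jump b v v')"
          using m1 m2 no(1)[of u] unfolding jump_def by auto
      qed
    qed
    then show "tight a b 2 ((\<lambda>(u, w, v). (u, v, w)) ` K)" by (rule tight_swap23)
  qed
qed

text \<open>
  With parameter 1 the chains of index 0 and 1 in the first two sides leave an \<open>(a - 2) \<times> (b - 2)\<close>
  rectangle without any point at the top of the first or at the bottom of the second side. There
  only runs along the third side are dangerous.
\<close>

lemma box_scd_tight:
  assumes "5 \<le> a" "5 \<le> b" "3 \<le> c"
  shows "box_scd a b c (tight a b c)"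
proof -
  have y: "1 < a" "1 < b" using assms by auto
  let ?A = "\<lambda>t. {(u, v, w). (u, v) \<in> zz_chain a b 1 t \<and> w < c}"
  let ?g = "\<lambda>(u :: nat, w :: nat, v :: nat). (u, v + 2, w)"
  let ?U = "{..<a - 2} \<times> {..<c} \<times> {..<b - 2}"
  have border: "has_scd le3 rk3 (a + b + c - 3) (tight a b c) (?A t)" if t: "t < 2" for t
  proof -
    have ta: "t < a" "t < b" "1 < c" "1 + 2 * t + 1 < a + b" using t assms by auto
    show ?thesis
    proof (rule has_scd_mono[OF has_scd_chain_times[OF y ta]])
      fix K assume "\<exists>s. s < c \<and> s + 2 * t + 1 < a + b \<and> K = lift_chain a b c 1 t 1 s"
      then obtain s where s: "s < c" "s + 2 * t + 1 < a + b" "K = lift_chain a b c 1 t 1 s" by blast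
      let ?l = "a + b - 1 - 2 * t"
      have l: "s < ?l" "3 \<le> ?l" using s t assms by auto
      note r1 = zz_chain_one_no_run[OF _ _ ta(1,2)] and r2 = zz_chain_one_no_run[OF assms(3) l(2) s(1) l(1)]
      show "tight a b c K" unfolding tight_def
      proof (intro allI impI)
        fix u v w u' v' w' assume K: "(u, v, w) \<in> K" "(u', v', w') \<in> K"
        have m: "(u, v) \<in> zz_chain a b 1 t" "(w, u + v - t) \<in> zz_chain c ?l 1 s"
          "(u', v') \<in> zz_chain a b 1 t" "(w', u' + v' - t) \<in> zz_chain c ?l 1 s"
          using K s(3) by (auto simp: lift_chain_iff)
        have ab: "3 \<le> a" "3 \<le> b" using assms by auto
        have 1: "\<not> (u = 0 \<and> u' = a - 1 \<and> v = v')" using m r1(1)[OF ab] by blast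
        have 2: "\<not> (u = u' \<and> v = 0 \<and> v' = b - 1)" using m r1(2)[OF ab] by blast
        have 3: "\<not> (w = 0 \<and> w' = c - 1 \<and> u = u' \<and> v = v')" using m r2(1) by blast
        \<comment> \<open>A jump of both first sides can only lie on the chain of index 0 and joins
          its first and last place; parameter 1 of the lift forbids this for fixed
          \<open>w\<close>.\<close>
        have 4: "\<not> (u = 0 \<and> v = 0 \<and> u' = a - 1 \<and> v' = b - 1 \<and> w = w')"
        proof
          assume *: "u = 0 \<and> v = 0 \<and> u' = a - 1 \<and> v' = b - 1 \<and> w = w'"
          then have "t = zz_index a b 1 (0, 0)" using m(1) mem_zz_chain_iff[OF y ta(1,2)] by auto
          then have "t = 0" using assms by (simp add: zz_index_def)
          then have "u' + v' - t = ?l - 1" using * assms by auto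
          moreover have "u + v - t = 0" using * by simp
          ultimately show False using m(2,4) * r2(2) by metis
        qed
        \<comment> \<open>The patterns combining a jump of the third side with another jump already
          contradict 1 or 2.\<close>
        show "\<not> (jump a u u' \<and> v = v' \<and> w = w') \<and> \<not> (u = u' \<and> jump b v v' \<and> w = w') \<and>
          \<not> (u = u' \<and> v = v' \<and> jump c w w') \<and> \<not> (jump a u u' \<and> jump b v v' \<and> w = w') \<and>
          \<not> (jump a u u' \<and> v = v' \<and> jump c w w') \<and> \<not> (u = u' \<and> jump b v v' \<and> jump c w w')"
          unfolding jump_def using 1 2 3 4 by blast
      qed
    qed
  qed
  have inner: "has_scd le3 rk3 (a + b + c - 3) (tight a b c) (?g ` ?U)"
  \<comment> \<open>The corner reaches from \<open>(0, 2, 0)\<close> to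
    \<open>(a - 3, b - 1, c - 1)\<close>, so it is centred with shift 2. The side of length
    \<open>c\<close> is listed second so that the zigzag controls the runs along it.\<close>
  proof (rule has_scd_image[where j = 2])
    have "box_scd (a - 2) c (b - 2) (\<lambda>K. K \<subseteq> ?U \<longrightarrow> tight a b c (?g ` K))"
    proof (rule box_scd_lift[where y = 1])
      fix K :: "(nat \<times> nat \<times> nat) set" and t assume t: "t < a - 2" "t < c" and K: "\<And>u v w. (u, v, w) \<in> K \<Longrightarrow> (u, v) \<in> zz_chain (a - 2) c 1 t \<and> w < b - 2"
      have "3 \<le> a - 2" using assms by simp
      note r = zz_chain_one_no_run(2)[OF this assms(3) t]
      show "K \<subseteq> ?U \<longrightarrow> tight a b c (?g ` K)"
        unfolding tight_def
      proof (intro allI impI)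
        fix u v w u' v' w' assume "K \<subseteq> ?U" "(u, v, w) \<in> ?g ` K" "(u', v', w') \<in> ?g ` K"
        then have "u' < a - 2" "2 \<le> v" "(u, w) \<in> zz_chain (a - 2) c 1 t" "(u', w') \<in> zz_chain (a - 2) c 1 t"
          using K by auto
        then show "\<not> (jump a u u' \<and> v = v' \<and> w = w') \<and> \<not> (u = u' \<and> jump b v v' \<and> w = w') \<and>
          \<not> (u = u' \<and> v = v' \<and> jump c w w') \<and> \<not> (jump a u u' \<and> jump b v v' \<and> w = w') \<and>
          \<not> (jump a u u' \<and> v = v' \<and> jump c w w') \<and> \<not> (u = u' \<and> jump b v v' \<and> jump c w w')"
          using r[of u] unfolding jump_def by auto
      qed
    qed (use assms in auto)
    then show "has_scd le3 rk3 (a - 2 + c + (b - 2) - 3) (\<lambda>K. K \<subseteq> ?U \<longrightarrow> tight a b c (?g ` K)) ?U"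
      unfolding box_scd_def .
  qed (use assms in \<open>auto simp: inj_on_def le3_def rk3_def\<close>)
  have mem: "(u, v) \<in> zz_chain a b 1 t \<longleftrightarrow> u < a \<and> v < b \<and> zz_index a b 1 (u, v) = t" if "t < 2" for u v t
    using mem_zz_chain_iff[OF y] that assms by auto
  have small: "zz_index a b 1 (u, v) < 2 \<longleftrightarrow> \<not> (u < a - 2 \<and> 2 \<le> v)" if "u < a" for u v
  proof (cases "u + 2 < a \<and> 1 < v")
    case False
    have "1 - v < 2" "u + 1 + 1 - a < 2" using that by linarith+
    then have "max (1 - v) (u + 1 + 1 - a) < 2" by simp
    then have "zz_index a b 1 (u, v) < 2"
      using False unfolding zz_index_def by (simp add: min_less_iff_disj)
    then show ?thesis using False by linarith
  qed (auto simp: zz_index_def)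
  have U: "?g ` ?U = {(u, v, w). u < a \<and> v < b \<and> w < c \<and> \<not> zz_index a b 1 (u, v) < 2}"
  proof (intro equalityI subsetI)
    fix p assume "p \<in> {(u, v, w). u < a \<and> v < b \<and> w < c \<and> \<not> zz_index a b 1 (u, v) < 2}"
    then obtain u v w where p: "p = (u, v, w)" "u < a - 2" "2 \<le> v" "v < b" "w < c"
      using small by auto
    then show "p \<in> ?g ` ?U" by (intro image_eqI[of _ _ "(u, w, v - 2)"]) auto
  next
    fix p assume "p \<in> ?g ` ?U"
    then obtain u v w where p: "p = (u, v + 2, w)" "u < a - 2" "v < b - 2" "w < c" by auto
    then show "p \<in> {(u, v, w). u < a \<and> v < b \<and> w < c \<and> \<not> zz_index a b 1 (u, v) < 2}"
      using small[of u "v + 2"] by auto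
  qed
  have A: "?A t = {(u, v, w). u < a \<and> v < b \<and> w < c \<and> zz_index a b 1 (u, v) = t}" if "t < 2" for t
    using mem[OF that] by auto
  have A01: "?A 0 = {(u, v, w). u < a \<and> v < b \<and> w < c \<and> zz_index a b 1 (u, v) = 0}"
    "?A 1 = {(u, v, w). u < a \<and> v < b \<and> w < c \<and> zz_index a b 1 (u, v) = 1}"
    by (rule A, simp)+
  have "has_scd le3 rk3 (a + b + c - 3) (tight a b c) (?A 0 \<union> (?A 1 \<union> ?g ` ?U))"
  proof (intro has_scd_Un border inner)
    show "?A 1 \<inter> ?g ` ?U = {}" "?A 0 \<inter> (?A 1 \<union> ?g ` ?U) = {}" unfolding A01 U by auto
  qed auto
  also have "?A 0 \<union> (?A 1 \<union> ?g ` ?U) = {..<a} \<times> {..<b} \<times> {..<c}"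
  proof -
    have "zz_index a b 1 (u, v) < 2 \<Longrightarrow> zz_index a b 1 (u, v) \<noteq> 0 \<Longrightarrow> zz_index a b 1 (u, v) = 1" for u v
      by linarith
    then show ?thesis unfolding A01 U by auto
  qed
  finally show ?thesis unfolding box_scd_def .
qed

text \<open>
  The designated elements of the first two sides are \<open>d\<close> and \<open>e\<close>.
\<close>

definition tame :: "nat \<Rightarrow> nat \<Rightarrow> nat \<Rightarrow> nat \<Rightarrow> nat \<Rightarrow> (nat \<times> nat \<times> nat) set \<Rightarrow> bool" where
  "tame a b c d e K \<longleftrightarrow> (\<forall>u v w u' v' w'. (u, v, w) \<in> K \<longrightarrow> (u', v', w') \<in> K \<longrightarrow>
     (jump a u u' \<and> v = v' \<and> w = w' \<longrightarrow> b \<le> 2 \<and> v = e) \<and>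
     (u = u' \<and> jump b v v' \<and> w = w' \<longrightarrow> a \<le> 2 \<and> u = d) \<and>
     (u = u' \<and> v = v' \<and> jump c w w' \<longrightarrow> a \<le> 2 \<and> u = d) \<and>
     (jump a u u' \<and> jump b v v' \<and> w = w' \<longrightarrow> c = 1) \<and>
     (jump a u u' \<and> v = v' \<and> jump c w w' \<longrightarrow> b \<le> 2 \<and> v = e) \<and>
     (u = u' \<and> jump b v v' \<and> jump c w w' \<longrightarrow> a \<le> 2 \<and> u = d))"

lemma tight_imp_tame: "tight a b c K \<Longrightarrow> tame a b c d e K"
  unfolding tight_def tame_def by blast

lemma no_jump: "\<not> 5 \<le> a \<Longrightarrow> \<not> jump a u u'"
  by (simp add: jump_def)

text \<open>Along a short second side the run is moved to the designated row; for a longer one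
  parameter 1 excludes it.\<close>

lemma zz_chain_run:
  assumes "5 \<le> a" "d < b" "t < a" "t < b"
    "(u, v) \<in> zz_chain a b (if b \<le> 2 then d else 1) t" "(u', v) \<in> zz_chain a b (if b \<le> 2 then d else 1) t"
    "jump a u u'"
  shows "b \<le> 2 \<and> v = d"
proof (cases "b \<le> 2")
  case True
  then show ?thesis using zz_chain_thin_run[OF assms(1,2) True assms(3,4)] assms(5-7)
    by (auto simp: jump_def)
next
  case False
  then show ?thesis using zz_chain_one_no_run(1)[OF _ _ assms(3,4)] assms(1,5-7)
    by (auto simp: jump_def)
qed

lemma zz_chain_no_jump:
  assumes "5 \<le> a" "5 \<le> b" "t < a" "t < b" "(u, v) \<in> zz_chain a b 1 t" "(u', v') \<in> zz_chain a b 1 t"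
  shows "\<not> (jump a u u' \<and> v = v')" "\<not> (u = u' \<and> jump b v v')"
  using zz_chain_one_no_run[OF _ _ assms(3,4)] assms by (auto simp: jump_def)

lemma box_scd_tame_tight: "box_scd a b c (tight a b c) \<Longrightarrow> box_scd a b c (tame a b c d e)"
  unfolding box_scd_def by (erule has_scd_mono) (rule tight_imp_tame)

section \<open>Tame decompositions for all side lengths\<close>

text \<open>Only sides of length at least 5 can jump, so the cases are the possible sets of long
  sides. A single long side is paired with a side whose designated element may be used. With two
  long sides the remaining one decides: length 1 is treated directly, length 2 as a flat box, and
  larger ones by \<open>box_scd_tight\<close>.\<close>

lemma box_scd_tame:
  assumes "0 < a" "0 < b" "0 < c" "d < a" "e < b"
  shows "box_scd a b c (tame a b c d e)"
proof -
  consider (none) "\<not> 5 \<le> a" "\<not> 5 \<le> b" "\<not> 5 \<le> c" | (A) "5 \<le> a" "\<not> 5 \<le> b" "\<not> 5 \<le> c"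
    | (B) "\<not> 5 \<le> a" "5 \<le> b" "\<not> 5 \<le> c" | (C) "\<not> 5 \<le> a" "\<not> 5 \<le> b" "5 \<le> c"
    | (AB) "5 \<le> a" "5 \<le> b" | (AC) "5 \<le> a" "5 \<le> c" | (BC) "5 \<le> b" "5 \<le> c"
    by blast
  then show ?thesis
  proof cases
    case none
    show ?thesis by (rule box_scd_lift[of 0]) (use none assms in \<open>auto simp: tame_def no_jump\<close>)
  next
    case A
    let ?y = "if b \<le> 2 then e else 1"
    show ?thesis
    proof (rule box_scd_lift[of ?y])
      fix K t assume t: "t < a" "t < b" and K: "\<And>u v w. (u, v, w) \<in> K \<Longrightarrow> (u, v) \<in> zz_chain a b ?y t \<and> w < c"
      have run: "b \<le> 2 \<and> v = e" if "(u, v, w) \<in> K" "(u', v, w) \<in> K" "jump a u u'" for u v w u'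
        by (rule zz_chain_run[OF A(1) assms(5) t]) (use that K in blast)+
      show "tame a b c d e K" unfolding tame_def using run no_jump[OF A(2)] no_jump[OF A(3)] by blast
    qed (use assms A in auto)
  next
    case B
    let ?y = "if a \<le> 2 then d else 1"
    show ?thesis
    proof (rule box_scd_swap12, rule box_scd_lift[of ?y])
      fix K t assume t: "t < b" "t < a" and K: "\<And>u v w. (u, v, w) \<in> K \<Longrightarrow> (u, v) \<in> zz_chain b a ?y t \<and> w < c"
      have run: "a \<le> 2 \<and> u = d" if "(v, u, w) \<in> K" "(v', u, w) \<in> K" "jump b v v'" for u v w v'
        by (rule zz_chain_run[OF B(2) assms(4) t]) (use that K in blast)+
      show "tame a b c d e ((\<lambda>(v, u, w). (u, v, w)) ` K)" unfolding tame_def swap12_iff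
        using run no_jump[OF B(1)] no_jump[OF B(3)] by blast
    qed (use assms B in auto)
  next
    case C
    let ?y = "if a \<le> 2 then d else 1"
    show ?thesis
    \<comment> \<open>The two swaps list the sides in the order \<open>c\<close>, \<open>a\<close>,
      \<open>b\<close>.\<close>
    proof (rule box_scd_swap23, rule box_scd_swap12, rule box_scd_lift[of ?y])
      fix K t assume t: "t < c" "t < a" and K: "\<And>u v w. (u, v, w) \<in> K \<Longrightarrow> (u, v) \<in> zz_chain c a ?y t \<and> w < b"
      have run: "a \<le> 2 \<and> u = d" if "(w, u, v) \<in> K" "(w', u, v) \<in> K" "jump c w w'" for u v w w'
        by (rule zz_chain_run[OF C(3) assms(4) t]) (use that K in blast)+
      show "tame a b c d e ((\<lambda>(u, w, v). (u, v, w)) ` (\<lambda>(v, u, w). (u, v, w)) ` K)"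
        unfolding tame_def swap12_iff swap23_iff
        using run no_jump[OF C(1)] no_jump[OF C(2)] by blast
    qed (use assms C in auto)
  next
    case AB
    consider "c = 1" | "c = 2" | "3 \<le> c" using assms by linarith
    then show ?thesis
    proof cases
      case 1
      \<comment> \<open>Parameter 1 excludes jumps of one long side; the joint jump of both is
        permitted because \<open>c = 1\<close>.\<close>
      then have nj: "\<not> 5 \<le> c" and le: "c \<le> 2" by auto
      show ?thesis
      proof (rule box_scd_lift[of 1])
        fix K t assume t: "t < a" "t < b" and K: "\<And>u v w. (u, v, w) \<in> K \<Longrightarrow> (u, v) \<in> zz_chain a b 1 t \<and> w < c"
        have "\<not> (jump a u u' \<and> v = v')" "\<not> (u = u' \<and> jump b v v')"
          if "(u, v, w) \<in> K" "(u', v', w') \<in> K" for u v w u' v' w'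
          using zz_chain_no_jump[OF AB t] that K by blast+
        then show "tame a b c d e K" unfolding tame_def using no_jump[OF nj] 1 by blast
      qed (use assms AB in auto)
    next
      case 2
      then show ?thesis using box_scd_tight_flat[OF AB] box_scd_tame_tight by simp
    next
      case 3
      then show ?thesis using box_scd_tight[OF AB] box_scd_tame_tight by simp
    qed
  next
    case AC
    have flip: "box_scd a c b (tight a c b) \<Longrightarrow> ?thesis"
      by (rule box_scd_tame_tight, rule box_scd_swap23, unfold box_scd_def)
        (erule has_scd_mono, rule tight_swap23)
    consider "b = 1" | "b = 2" | "3 \<le> b" using assms by linarith
    then show ?thesis
    proof cases
      case 1
      then have nj: "\<not> 5 \<le> b" and le: "b \<le> 2" by auto
      show ?thesis
      proof (rule box_scd_swap23, rule box_scd_lift[of 1])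
        fix K t assume t: "t < a" "t < c" and K: "\<And>u v w. (u, v, w) \<in> K \<Longrightarrow> (u, v) \<in> zz_chain a c 1 t \<and> w < b"
        have "\<not> (jump a u u' \<and> w = w')" "\<not> (u = u' \<and> jump c w w')"
          if "(u, w, v) \<in> K" "(u', w', v') \<in> K" for u v w u' v' w'
          using zz_chain_no_jump[OF AC t] that K by blast+
        \<comment> \<open>The only value of \<open>v\<close> is designated, which settles the
          patterns where the first side jumps. Jumps of the third side alone are excluded by
          parameter 1.\<close>
        moreover have "v = e" if "(u, w, v) \<in> K" for u v w using K[OF that] 1 assms(5) by simp
        ultimately show "tame a b c d e ((\<lambda>(u, w, v). (u, v, w)) ` K)"
          unfolding tame_def swap23_iff using no_jump[OF nj] le 1 by blast
      qed (use assms AC in auto)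
    next
      case 2
      then show ?thesis using box_scd_tight_flat[OF AC] flip by simp
    next
      case 3
      then show ?thesis using box_scd_tight[OF AC] flip by simp
    qed
  next
    case BC
    have flip: "box_scd b c a (tight b c a) \<Longrightarrow> ?thesis"
      by (rule box_scd_tame_tight, rule box_scd_swap12, rule box_scd_swap23, unfold box_scd_def)
        (erule has_scd_mono, rule tight_swap12, rule tight_swap23)
    consider "a = 1" | "a = 2" | "3 \<le> a" using assms by linarith
    then show ?thesis
    proof cases
      case 1
      then have nj: "\<not> 5 \<le> a" and le: "a \<le> 2" by auto
      show ?thesis
      proof (rule box_scd_lift[of 0])
        fix K t assume t: "t < a" "t < b" and K: "\<And>u v w. (u, v, w) \<in> K \<Longrightarrow> (u, v) \<in> zz_chain a b 0 t \<and> w < c"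
        \<comment> \<open>The only value of \<open>u\<close> is designated, so every pattern without
          a jump of the first side meets its exception.\<close>
        have "u = d" if "(u, v, w) \<in> K" for u v w
          using K[OF that] 1 assms(4) mem_zz_chain_iff[OF assms(1,2) t, of u v] by simp
        then show "tame a b c d e K" unfolding tame_def using no_jump[OF nj] le 1 by blast
      qed (use assms in auto)
    next
      case 2
      then show ?thesis using box_scd_tight_flat[OF BC] flip by simp
    next
      case 3
      then show ?thesis using box_scd_tight[OF BC] flip by simp
    qed
  qed
qed

section \<open>Almost orthogonal decompositions of products of cubes\<close>

text \<open>Places in a chain, counted from its smallest set of size \<open>j\<close>, serve as
  natural number coordinates on cuboids.\<close>

lemma symmetric_chain_enum:
  assumes "symmetric_chain n C"
  obtains j f where "n + 1 = 2 * j + card C" "0 < card C" "C = f ` {..<card C}"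
    "\<And>i. i < card C \<Longrightarrow> card (f i) = j + i" "\<And>i i'. i \<le> i' \<Longrightarrow> i' < card C \<Longrightarrow> f i \<subseteq> f i'"
proof -
  obtain j where ch: "subset.chain (Pow {1..n}) C" and j: "j \<le> n - j" "bij_betw card C {j..n - j}"
    using assms unfolding symmetric_chain_def by blast
  have c: "card C = n - j + 1 - j" using bij_betw_same_card[OF j(2)] by simp
  define f where "f i = the_inv_into C card (j + i)" for i
  have inj: "inj_on card C" and im: "card ` C = {j..n - j}" using j(2) by (auto simp: bij_betw_def)
  have f: "f i \<in> C" "card (f i) = j + i" if "i < card C" for i
  proof -
    have "j + i \<in> card ` C" unfolding im using that c by simp
    then show "f i \<in> C" "card (f i) = j + i"
      unfolding f_def using the_inv_into_into[OF inj _ order_refl] f_the_inv_into_f[OF inj] by auto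
  qed
  have "C \<subseteq> f ` {..<card C}"
  proof
    fix x assume x: "x \<in> C"
    then have "card x \<in> {j..n - j}" using im by blast
    then have "card x - j < card C" "f (card x - j) = x"
      using c x the_inv_into_f_f[OF inj x] by (auto simp: f_def)
    then show "x \<in> f ` {..<card C}" by (metis imageI lessThan_iff)
  qed
  then have C: "C = f ` {..<card C}" using f(1) by blast
  have "f i \<subseteq> f i'" if "i \<le> i'" "i' < card C" for i i'
  proof -
    have "f i \<in> C" "f i' \<in> C" using f(1) that by auto
    then have "f i \<subset> f i' \<or> f i = f i' \<or> f i' \<subset> f i" and sub: "f i' \<subseteq> {1..n}" "f i \<subseteq> {1..n}"
      using ch unfolding subset.chain_def by blast+
    then have cmp: "f i \<subseteq> f i' \<or> f i' \<subseteq> f i" by auto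
    then show ?thesis
      using f(2)[of i] f(2)[of i'] that card_seteq[OF finite_subset[OF sub(2)], of "f i'"] by auto
  qed
  moreover have "n + 1 = 2 * j + card C" "0 < card C" using c j(1) by auto
  ultimately show thesis using C f(2) by (intro that[of j f]) auto
qed

definition top_jump :: "nat \<Rightarrow> nat set \<Rightarrow> nat set \<Rightarrow> bool" where
  "top_jump n x x' \<longleftrightarrow> x = {} \<and> x' = {1..n}"

text \<open>The counterpart of \<open>tame\<close> for sets: membership in the designated sets takes
  over the conditions that a side be short.\<close>

definition cube_tame :: "nat \<Rightarrow> nat \<Rightarrow> nat \<Rightarrow> nat set set \<Rightarrow> nat set set \<Rightarrow> nat set set \<Rightarrow>
    (nat set \<times> nat set \<times> nat set) set \<Rightarrow> bool" where
  "cube_tame m n p D D' D'' K \<longleftrightarrow> (\<forall>x y z x' y' z'. (x, y, z) \<in> K \<longrightarrow> (x', y', z') \<in> K \<longrightarrow>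
     (top_jump m x x' \<and> y = y' \<and> z = z' \<longrightarrow> y \<in> D') \<and>
     (x = x' \<and> top_jump n y y' \<and> z = z' \<longrightarrow> x \<in> D) \<and>
     (x = x' \<and> y = y' \<and> top_jump p z z' \<longrightarrow> x \<in> D) \<and>
     (top_jump m x x' \<and> top_jump n y y' \<and> z = z' \<longrightarrow> z \<in> D'') \<and>
     (top_jump m x x' \<and> y = y' \<and> top_jump p z z' \<longrightarrow> y \<in> D') \<and>
     (x = x' \<and> top_jump n y y' \<and> top_jump p z z' \<longrightarrow> x \<in> D))"

definition card3 :: "nat set \<times> nat set \<times> nat set \<Rightarrow> nat" where
  "card3 = (\<lambda>(x, y, z). card x + card y + card z)"

text \<open>The enumerations identify the cuboid with a box whose lowest point has rank
  \<open>j + j' + j''\<close>; tameness of the box then translates back.\<close>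

lemma has_scd_cuboid:
  assumes "4 \<le> m" "4 \<le> n" "4 \<le> p"
    and ch: "symmetric_chain m A" "symmetric_chain n B" "symmetric_chain p C"
    and D: "card A \<le> 2 \<Longrightarrow> A \<inter> D \<noteq> {}" "card B \<le> 2 \<Longrightarrow> B \<inter> D' \<noteq> {}" "card C = 1 \<Longrightarrow> C \<subseteq> D''"
  shows "has_scd le3 card3 (m + n + p) (cube_tame m n p D D' D'') (A \<times> B \<times> C)"
proof -
  obtain j f where f: "m + 1 = 2 * j + card A" "0 < card A" "A = f ` {..<card A}"
    "\<And>i. i < card A \<Longrightarrow> card (f i) = j + i" "\<And>i i'. i \<le> i' \<Longrightarrow> i' < card A \<Longrightarrow> f i \<subseteq> f i'"
    using symmetric_chain_enum[OF ch(1)] by blast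
  obtain j' g where g: "n + 1 = 2 * j' + card B" "0 < card B" "B = g ` {..<card B}"
    "\<And>i. i < card B \<Longrightarrow> card (g i) = j' + i" "\<And>i i'. i \<le> i' \<Longrightarrow> i' < card B \<Longrightarrow> g i \<subseteq> g i'"
    using symmetric_chain_enum[OF ch(2)] by blast
  obtain j'' h where h: "p + 1 = 2 * j'' + card C" "0 < card C" "C = h ` {..<card C}"
    "\<And>i. i < card C \<Longrightarrow> card (h i) = j'' + i" "\<And>i i'. i \<le> i' \<Longrightarrow> i' < card C \<Longrightarrow> h i \<subseteq> h i'"
    using symmetric_chain_enum[OF ch(3)] by blast
  \<comment> \<open>\<open>d\<close> is the place of a designated element if the chain is short;
    otherwise any place serves.\<close>
  have "\<exists>d<card A. card A \<le> 2 \<longrightarrow> f d \<in> D"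
  proof (cases "card A \<le> 2")
    case True
    then obtain x where "x \<in> A" "x \<in> D" using D(1) by blast
    moreover obtain d where "d < card A" "x = f d" using \<open>x \<in> A\<close> f(3) by blast
    ultimately show ?thesis by blast
  qed (use f(2) in blast)
  then obtain d where d: "d < card A" "card A \<le> 2 \<Longrightarrow> f d \<in> D" by blast
  have "\<exists>e<card B. card B \<le> 2 \<longrightarrow> g e \<in> D'"
  proof (cases "card B \<le> 2")
    case True
    then obtain x where "x \<in> B" "x \<in> D'" using D(2) by blast
    moreover obtain d where "d < card B" "x = g d" using \<open>x \<in> B\<close> g(3) by blast
    ultimately show ?thesis by blast
  qed (use g(2) in blast)
  then obtain e where e: "e < card B" "card B \<le> 2 \<Longrightarrow> g e \<in> D'" by blast
  let ?box = "{..<card A} \<times> {..<card B} \<times> {..<card C}"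
  let ?\<phi> = "\<lambda>(u, v, w). (f u, g v, h w)"
  have inj: "u = u'" if "f u = f u'" "u < card A" "u' < card A" for u u'
    using f(4) that by (metis add_left_cancel)
  have inj': "u = u'" if "g u = g u'" "u < card B" "u' < card B" for u u'
    using g(4) that by (metis add_left_cancel)
  have inj'': "u = u'" if "h u = h u'" "u < card C" "u' < card C" for u u'
    using h(4) that by (metis add_left_cancel)
  \<comment> \<open>A chain through the empty and the full set has \<open>j = 0\<close> and
    \<open>m + 1 \<ge> 5\<close> elements.\<close>
  have jump: "jump (card A) u u'" if "top_jump m (f u) (f u')" "u < card A" "u' < card A" for u u'
  proof -
    have "card (f u) = 0" "card (f u') = m" using that(1) by (auto simp: top_jump_def)
    then show ?thesis using f(1) f(4)[OF that(2)] f(4)[OF that(3)] assms(1) unfolding jump_def by linarith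
  qed
  have jump': "jump (card B) u u'" if "top_jump n (g u) (g u')" "u < card B" "u' < card B" for u u'
  proof -
    have "card (g u) = 0" "card (g u') = n" using that(1) by (auto simp: top_jump_def)
    then show ?thesis using g(1) g(4)[OF that(2)] g(4)[OF that(3)] assms(2) unfolding jump_def by linarith
  qed
  have jump'': "jump (card C) u u'" if "top_jump p (h u) (h u')" "u < card C" "u' < card C" for u u'
  proof -
    have "card (h u) = 0" "card (h u') = p" using that(1) by (auto simp: top_jump_def)
    then show ?thesis using h(1) h(4)[OF that(2)] h(4)[OF that(3)] assms(3) unfolding jump_def by linarith
  qed
  have "has_scd le3 card3 (m + n + p) (cube_tame m n p D D' D'') (?\<phi> ` ?box)"
  proof (rule has_scd_image[where j = "j + j' + j''"])
    show "has_scd le3 rk3 (card A + card B + card C - 3) (tame (card A) (card B) (card C) d e) ?box"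
      using box_scd_tame[OF f(2) g(2) h(2) d(1) e(1)] unfolding box_scd_def .
    show "inj_on ?\<phi> ?box" by (auto simp: inj_on_def dest: inj inj' inj'')
    show "card3 (?\<phi> x) = j + j' + j'' + rk3 x" if "x \<in> ?box" for x
      using that f(4) g(4) h(4) by (auto simp: card3_def rk3_def)
    show "m + n + p = card A + card B + card C - 3 + 2 * (j + j' + j'')"
    proof -
      have "m + n + p + 3 = card A + card B + card C + 2 * (j + j' + j'')" using f(1) g(1) h(1) by simp
      then show ?thesis using f(2) g(2) h(2) by linarith
    qed
    show "le3 (?\<phi> x) (?\<phi> y)" if "x \<in> ?box" "y \<in> ?box" "le3 x y" for x y
      using that f(5) g(5) h(5) by (cases x, cases y) (simp add: le3_def)
    fix K assume K: "K \<subseteq> ?box" "tame (card A) (card B) (card C) d e K"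
    show "cube_tame m n p D D' D'' (?\<phi> ` K)"
      unfolding cube_tame_def
    proof (intro allI impI)
      fix x y z x' y' z' assume "(x, y, z) \<in> ?\<phi> ` K" "(x', y', z') \<in> ?\<phi> ` K"
      then obtain u v w u' v' w' where uvw: "(u, v, w) \<in> K" "(u', v', w') \<in> K"
        and x: "x = f u" "y = g v" "z = h w" "x' = f u'" "y' = g v'" "z' = h w'" by auto
      have b: "u < card A" "v < card B" "w < card C" "u' < card A" "v' < card B" "w' < card C"
        using uvw K(1) by auto
      have iff: "x = x' \<longleftrightarrow> u = u'" "y = y' \<longleftrightarrow> v = v'" "z = z' \<longleftrightarrow> w = w'"
        using inj inj' inj'' b x by blast+
      have imp: "top_jump m x x' \<Longrightarrow> jump (card A) u u'" "top_jump n y y' \<Longrightarrow> jump (card B) v v'"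
        "top_jump p z z' \<Longrightarrow> jump (card C) w w'"
        using jump jump' jump'' b x by blast+
      have con: "card A \<le> 2 \<and> u = d \<Longrightarrow> x \<in> D" "card B \<le> 2 \<and> v = e \<Longrightarrow> y \<in> D'" "card C = 1 \<Longrightarrow> z \<in> D''"
        using d e D(3) h(3) b x by blast+
      show "(top_jump m x x' \<and> y = y' \<and> z = z' \<longrightarrow> y \<in> D') \<and>
        (x = x' \<and> top_jump n y y' \<and> z = z' \<longrightarrow> x \<in> D) \<and>
        (x = x' \<and> y = y' \<and> top_jump p z z' \<longrightarrow> x \<in> D) \<and>
        (top_jump m x x' \<and> top_jump n y y' \<and> z = z' \<longrightarrow> z \<in> D'') \<and>
        (top_jump m x x' \<and> y = y' \<and> top_jump p z z' \<longrightarrow> y \<in> D') \<and>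
        (x = x' \<and> top_jump n y y' \<and> top_jump p z z' \<longrightarrow> x \<in> D)"
        using K(2)[unfolded tame_def, rule_format, OF uvw] imp con unfolding iff by blast
    qed
  qed
  also have "?\<phi> ` ?box = A \<times> B \<times> C"
  proof -
    have "?\<phi> ` ?box = f ` {..<card A} \<times> g ` {..<card B} \<times> h ` {..<card C}" by force
    then show ?thesis using f(3) g(3) h(3) by simp
  qed
  finally show ?thesis .
qed

section \<open>Shared elements and the bound on the dimension\<close>

text \<open>Two common elements force the exceptional clause of almost orthogonality, which then
  determines the whole intersection.\<close>

lemma almost_orthogonal_Int:
  assumes "almost_orthogonal n \<F> \<G>" "A \<in> \<F>" "B \<in> \<G>" "finite A" "0 < n"
    "x \<in> A" "y \<in> A" "x \<in> B" "y \<in> B" "x \<noteq> y"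
  shows "{x, y} = {{}, {1..n}}"
proof -
  have two: "{x, y} \<subseteq> A \<inter> B" "card {x, y} = 2" "finite (A \<inter> B)" using assms by auto
  have "card (A \<inter> B) \<ge> 2" using card_mono[OF two(3,1)] two(2) by simp
  then have b: "{{}, {1..n}} \<subseteq> A \<inter> B" "card (A \<inter> B) = 2"
    using assms(1-3) unfolding almost_orthogonal_def by (force split: if_splits)+
  have "card {{}, {1..n}} = 2" using assms(5) by auto
  then show ?thesis using b two card_subset_eq[OF two(3)] by metis
qed

lemma scdD:
  assumes "scd n \<F>" "A \<in> \<F>"
  shows "symmetric_chain n A" "finite A" "A \<subseteq> Pow {1..n}"
proof -
  show "symmetric_chain n A" using assms by (auto simp: scd_def)
  then show "A \<subseteq> Pow {1..n}" by (auto simp: symmetric_chain_def subset.chain_def)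
  then show "finite A" using finite_subset by blast
qed

text \<open>A symmetric chain reaches from size \<open>j\<close> up to \<open>n - j\<close>, so it
  continues above any set below the middle.\<close>

lemma scd_successor:
  assumes "scd n \<F>" "x \<subseteq> {1..n}" "2 * card x < n"
  shows "\<exists>A\<in>\<F>. \<exists>y. x \<in> A \<and> y \<in> A \<and> card y = card x + 1 \<and> x \<subseteq> y \<and> y \<subseteq> {1..n}"
proof -
  have "x \<in> \<Union>\<F>" using assms(1,2) by (simp add: scd_def partition_on_def)
  then obtain A where A: "A \<in> \<F>" "x \<in> A" by blast
  obtain j f where f: "n + 1 = 2 * j + card A" "0 < card A" "A = f ` {..<card A}"
    "\<And>i. i < card A \<Longrightarrow> card (f i) = j + i" "\<And>i i'. i \<le> i' \<Longrightarrow> i' < card A \<Longrightarrow> f i \<subseteq> f i'"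
    using symmetric_chain_enum[OF scdD(1)[OF assms(1) A(1)]] by blast
  obtain i where i: "i < card A" "x = f i" using A(2) f(3) by blast
  have i1: "i + 1 < card A" using i(1) f(1) f(4)[OF i(1)] assms(3) unfolding i(2) by linarith
  then have "f (i + 1) \<in> A" using f(3) by blast
  then show ?thesis using A i i1 f(4)[OF i(1)] f(4)[OF i1] f(5)[of i "i + 1"] scdD(3)[OF assms(1) A(1)]
    by (intro bexI[OF _ A(1)] exI[of _ "f (i + 1)"]) auto
qed

text \<open>Almost orthogonality makes the successors of one set in three decompositions distinct,
  which takes three elements outside that set.\<close>

lemma dimension_ge_4:
  assumes "almost_orthogonal_scds n k \<F>" "3 \<le> k" "2 \<le> n"
  shows "4 \<le> n"
proof (rule ccontr)
  assume "\<not> 4 \<le> n"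
  then have n: "n = 2 \<or> n = 3" using assms(3) by linarith
  \<comment> \<open>A set below the middle that misses exactly two elements.\<close>
  define x where "x = (if n = 2 then {} else {1 :: nat})"
  have x: "x \<subseteq> {1..n}" "2 * card x < n" "card ({1..n} - x) = 2" using n by (auto simp: x_def)
  have "\<forall>i\<in>{1, 2, 3}. \<exists>y. (\<exists>A\<in>\<F> i. x \<in> A \<and> y \<in> A) \<and> card y = card x + 1 \<and> x \<subseteq> y \<and> y \<subseteq> {1..n}"
  proof
    fix i :: nat assume "i \<in> {1, 2, 3}"
    then have "scd n (\<F> i)" using assms(1,2) by (auto simp: almost_orthogonal_scds_def)
    from scd_successor[OF this x(1,2)] show "\<exists>y. (\<exists>A\<in>\<F> i. x \<in> A \<and> y \<in> A) \<and> card y = card x + 1 \<and> x \<subseteq> y \<and> y \<subseteq> {1..n}"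
      by blast
  qed
  then obtain y where y: "\<And>i. i \<in> {1, 2, 3} \<Longrightarrow> \<exists>A\<in>\<F> i. x \<in> A \<and> y i \<in> A"
    "\<And>i. i \<in> {1, 2, 3} \<Longrightarrow> card (y i) = card x + 1 \<and> x \<subseteq> y i \<and> y i \<subseteq> {1..n}"
    by metis
  have "\<exists>a. y i = insert a x \<and> a \<in> {1..n} - x" if "i \<in> {1, 2, 3}" for i
  proof -
    have "finite x" using x(1) finite_subset by blast
    then have "card (y i - x) = 1" using y(2)[OF that] by (simp add: card_Diff_subset)
    then obtain a where "y i - x = {a}" using card_1_singletonE by blast
    then show ?thesis using y(2)[OF that] by blast
  qed
  then obtain a where a: "\<And>i. i \<in> {1, 2, 3} \<Longrightarrow> y i = insert (a i) x \<and> a i \<in> {1..n} - x" by metis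
  have "inj_on a {1, 2, 3}"
  proof (rule inj_onI, rule ccontr)
    fix i j assume ij: "i \<in> {1, 2, 3}" "j \<in> {1, 2, 3}" "a i = a j" "i \<noteq> j"
    then have ij': "i \<in> {1..k}" "j \<in> {1..k}" and yy: "y i = y j" using assms(2) a by auto
    obtain A B where AB: "A \<in> \<F> i" "x \<in> A" "y i \<in> A" "B \<in> \<F> j" "x \<in> B" "y i \<in> B"
      using y(1)[OF ij(1)] y(1)[OF ij(2)] yy by auto
    have "almost_orthogonal n (\<F> i) (\<F> j)" "scd n (\<F> i)"
      using assms(1) ij(4) ij' by (auto simp: almost_orthogonal_scds_def pairwise_def)
    moreover have "x \<noteq> y i" using y(2)[OF ij(1)] by auto
    ultimately have "{x, y i} = {{}, {1..n}}"
      using almost_orthogonal_Int[of n "\<F> i" "\<F> j" A B x "y i"] AB scdD(2) assms(3) by auto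
    \<comment> \<open>In the exceptional pair the full set \<open>y i\<close> would have one
      element, against \<open>2 \<le> n\<close>.\<close>
    then have "x = {} \<and> y i = {1..n} \<or> y i = {}" by (auto simp: doubleton_eq_iff)
    then show False using y(2)[OF ij(1)] assms(3) by auto
  qed
  then have "card {1, 2, 3 :: nat} \<le> card ({1..n} - x)"
    by (rule card_inj_on_le) (use a in auto)
  then show False using x(3) by simp
qed

section \<open>Designated elements\<close>

lemma symmetric_chain_card:
  assumes "symmetric_chain n C"
  shows "even (card C) \<longleftrightarrow> odd n" "0 < card C" "{} \<in> C \<Longrightarrow> card C = n + 1"
proof -
  obtain j f where f: "n + 1 = 2 * j + card C" "0 < card C" "C = f ` {..<card C}"
    "\<And>i. i < card C \<Longrightarrow> card (f i) = j + i" "\<And>i i'. i \<le> i' \<Longrightarrow> i' < card C \<Longrightarrow> f i \<subseteq> f i'"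
    using symmetric_chain_enum[OF assms] by blast
  show "0 < card C" by (rule f(2))
  show "even (card C) \<longleftrightarrow> odd n" using f(1) by presburger
  assume "{} \<in> C"
  then obtain i where "i < card C" "f i = {}" using f(3) by (metis imageE lessThan_iff)
  then show "card C = n + 1" using f(1) f(4)[of i] by simp
qed

text \<open>In odd dimension all chains have even size, so empty sets serve; in even dimension
  goodness separates the one-element chains.\<close>

lemma good_singletons:
  assumes "almost_orthogonal_scds n k \<F>" "good n k \<F> \<or> odd n"
  shows "\<exists>D. (\<forall>i\<in>{1..k}. \<forall>A\<in>\<F> i. card A = 1 \<longrightarrow> A \<subseteq> D i) \<and>
    (\<forall>i\<in>{1..k}. \<forall>j\<in>{1..k}. i \<noteq> j \<longrightarrow> D i \<inter> D j = {})"
proof (cases "odd n")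
  case True
  have "card A \<noteq> 1" if "i \<in> {1..k}" "A \<in> \<F> i" for i A
  proof -
    have "scd n (\<F> i)" using assms(1) that(1) by (auto simp: almost_orthogonal_scds_def)
    from symmetric_chain_card(1)[OF scdD(1)[OF this that(2)]] True show ?thesis by auto
  qed
  then show ?thesis by (intro exI[of _ "\<lambda>_. {}"]) auto
next
  case False
  then have g: "\<And>i j A B. i \<in> {1..k} \<Longrightarrow> j \<in> {1..k} \<Longrightarrow> i \<noteq> j \<Longrightarrow> A \<in> \<F> i \<Longrightarrow> B \<in> \<F> j \<Longrightarrow>
      card A = 1 \<Longrightarrow> card B = 1 \<Longrightarrow> A \<noteq> B"
    using assms(2) unfolding good_def by blast
  have "D \<inter> E = {}"
    if DE: "D = \<Union>{A \<in> \<F> i. card A = 1}" "E = \<Union>{A \<in> \<F> j. card A = 1}"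
      and ij: "i \<in> {1..k}" "j \<in> {1..k}" "i \<noteq> j" for i j D E
  proof (rule ccontr)
    assume "D \<inter> E \<noteq> {}"
    then obtain u A B where AB: "u \<in> A" "u \<in> B" "A \<in> \<F> i" "B \<in> \<F> j" "card A = 1" "card B = 1"
      using DE by blast
    then have "A = B" by (metis card_1_singletonE singletonD)
    then show False using g[OF ij AB(3-6)] by blast
  qed
  then show ?thesis by (intro exI[of _ "\<lambda>i. \<Union>{A \<in> \<F> i. card A = 1}"]) blast
qed

text \<open>By parity, chains of size at most 2 have size 1 in even and size 2 in odd dimension. In
  the odd case a common tail for two decompositions has only one head, so the whole two-element
  chain would be shared.\<close>

lemma good_designated:
  assumes "good n k \<F>" "2 \<le> n"
  shows "\<exists>D. (\<forall>i\<in>{1..k}. \<forall>A\<in>\<F> i. card A \<le> 2 \<longrightarrow> A \<inter> D i \<noteq> {}) \<and>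
    (\<forall>i\<in>{1..k}. \<forall>j\<in>{1..k}. i \<noteq> j \<longrightarrow> D i \<inter> D j = {})"
proof -
  have orth: "almost_orthogonal_scds n k \<F>" using assms(1) by (simp add: good_def)
  then have scd: "scd n (\<F> i)" if "i \<in> {1..k}" for i
    using that by (auto simp: almost_orthogonal_scds_def)
  note ch = scdD(1)[OF scd]
  show ?thesis
  proof (cases "even n")
    case True
    obtain D where D: "\<forall>i\<in>{1..k}. \<forall>A\<in>\<F> i. card A = 1 \<longrightarrow> A \<subseteq> D i"
      "\<forall>i\<in>{1..k}. \<forall>j\<in>{1..k}. i \<noteq> j \<longrightarrow> D i \<inter> D j = {}"
      using good_singletons[OF orth disjI1[OF assms(1)]] by blast
    have "A \<inter> D i \<noteq> {}" if "i \<in> {1..k}" "A \<in> \<F> i" "card A \<le> 2" for i A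
    proof -
      have "odd (card A)" using symmetric_chain_card(1)[OF ch[OF that(1,2)]] True by simp
      then have "card A = 1" using that(3) by presburger
      then have "A \<subseteq> D i" "A \<noteq> {}" using D(1) that(1,2) by auto
      then show ?thesis by blast
    qed
    then show ?thesis using D(2) by blast
  next
    case False
    then obtain R where R: "orientation (two_element_chains k \<F>) R"
      "\<And>u. u \<in> \<Union>(two_element_chains k \<F>) \<Longrightarrow> out_degree R u \<le> 1"
      using assms(1) unfolding good_def by blast
    define D where "D i = {u. \<exists>v. u \<noteq> v \<and> {u, v} \<in> \<F> i \<and> (u, v) \<in> R}" for i
    have 1: "A \<inter> D i \<noteq> {}" if "i \<in> {1..k}" "A \<in> \<F> i" "card A \<le> 2" for i A
    proof -
      have "even (card A)" "0 < card A" using symmetric_chain_card[OF ch[OF that(1,2)]] False by simp_all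
      then have "card A = 2" using that(3) by presburger
      then obtain u v where uv: "A = {u, v}" "u \<noteq> v" by (meson card_2_iff)
      have "{u, v} \<in> two_element_chains k \<F>"
        using that \<open>card A = 2\<close> uv(1) by (auto simp: two_element_chains_def)
      then have "(u, v) \<in> R \<or> (v, u) \<in> R" using R(1) uv(2) unfolding orientation_def by blast
      moreover have "{u, v} \<in> \<F> i" "{v, u} \<in> \<F> i" using that(2) uv(1) by (simp_all add: insert_commute)
      ultimately have "u \<in> D i \<or> v \<in> D i" using uv(2) unfolding D_def by blast
      then show ?thesis using uv(1) by blast
    qed
    have 2: "D i \<inter> D j = {}" if ij: "i \<in> {1..k}" "j \<in> {1..k}" "i \<noteq> j" for i j
    proof (rule ccontr)
      assume "D i \<inter> D j \<noteq> {}"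
      then obtain u v v' where u: "u \<noteq> v" "{u, v} \<in> \<F> i" "(u, v) \<in> R" "u \<noteq> v'" "{u, v'} \<in> \<F> j" "(u, v') \<in> R"
        unfolding D_def by blast
      have in2: "{u, v} \<in> two_element_chains k \<F>" using u(1,2) ij(1) by (auto simp: two_element_chains_def)
      \<comment> \<open>Finiteness matters, since \<open>card\<close> of an infinite set is 0 and
        would satisfy the out-degree bound.\<close>
      have "R `` {u} \<subseteq> Pow {1..n}"
      proof
        fix w assume "w \<in> R `` {u}"
        then have "{u, w} \<in> two_element_chains k \<F>" using R(1) unfolding orientation_def by blast
        then obtain l where "l \<in> {1..k}" "{u, w} \<in> \<F> l" by (auto simp: two_element_chains_def)
        then show "w \<in> Pow {1..n}" using scdD(3)[OF scd] by blast
      qed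
      then have "finite (R `` {u})" by (rule finite_subset) simp
      moreover have "card (R `` {u}) \<le> 1" using R(2)[of u] in2 unfolding out_degree_def by blast
      moreover have "v \<in> R `` {u}" "v' \<in> R `` {u}" using u by auto
      ultimately have "v = v'" using card_le_Suc0_iff_eq[of "R `` {u}"] by simp
      have "almost_orthogonal n (\<F> i) (\<F> j)"
        using orth ij by (auto simp: almost_orthogonal_scds_def pairwise_def)
      then have "{u, v} = {{}, {1..n}}"
        using almost_orthogonal_Int[of n "\<F> i" "\<F> j" "{u, v}" "{u, v}" u v] u \<open>v = v'\<close> assms(2) by simp
      then have "{} \<in> {u, v}" by simp
      \<comment> \<open>The shared chain contains the empty set and would have
        \<open>n + 1 \<ge> 3\<close> elements instead of 2.\<close>
      from symmetric_chain_card(3)[OF ch[OF ij(1) u(2)] this] show False using u(1) assms(2) by simp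
    qed
    show ?thesis using 1 2 by blast
  qed
qed

section \<open>Combining the cuboids\<close>

lemma has_scd_subset:
  "has_scd le rk N P G \<Longrightarrow> has_scd le rk N (\<lambda>K. P K \<and> K \<subseteq> G) G"
  unfolding has_scd_def partition_on_def by blast

lemma symch_comparable:
  assumes "symch le rk N K" "s \<in> K" "t \<in> K"
  shows "le s t \<or> le t s"
proof -
  obtain j f where f: "K = f ` {j..N - j}" "\<forall>r r'. j \<le> r \<longrightarrow> r \<le> r' \<longrightarrow> r' \<le> N - j \<longrightarrow> le (f r) (f r')"
    using assms(1) unfolding symch_def by blast
  obtain r where r: "r \<in> {j..N - j}" "s = f r" using assms(2) f(1) by blast
  obtain r' where r': "r' \<in> {j..N - j}" "t = f r'" using assms(3) f(1) by blast
  show ?thesis using r r' f(2) by (cases "r \<le> r'") auto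
qed

lemma top_jump_of_meet:
  assumes "almost_orthogonal n \<F> \<G>" "scd n \<F>" "A \<in> \<F>" "B \<in> \<G>" "0 < n"
    "x \<in> A" "y \<in> A" "x \<in> B" "y \<in> B" "x \<subseteq> y"
  shows "x = y \<or> top_jump n x y"
proof (cases "x = y")
  case False
  have "{x, y} = {{}, {1..n}}"
    by (rule almost_orthogonal_Int[OF assms(1,3,4) scdD(2)[OF assms(2,3)] assms(5-9) False])
  then show ?thesis using assms(10) unfolding top_jump_def by (auto simp: doubleton_eq_iff)
qed simp

lemma almost_orthogonal_product:
  assumes "almost_orthogonal_scds m k \<F>" "almost_orthogonal_scds n k \<G>" "almost_orthogonal_scds p k \<H>"
    and "3 \<le> k" "2 \<le> m" "2 \<le> n" "2 \<le> p"
    and "good m k \<F>" "good n k \<G>" "good p k \<H> \<or> odd p"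
  shows "\<exists>\<E>. (\<forall>i\<in>{1..k}. partition_on (Pow {1..m} \<times> Pow {1..n} \<times> Pow {1..p}) (\<E> i) \<and>
      (\<forall>K\<in>\<E> i. symch le3 card3 (m + n + p) K \<and> (\<exists>A\<in>\<F> i. \<exists>B\<in>\<G> i. \<exists>C\<in>\<H> i. K \<subseteq> A \<times> B \<times> C))) \<and>
    (\<forall>i\<in>{1..k}. \<forall>j\<in>{1..k}. i \<noteq> j \<longrightarrow> (\<forall>K\<in>\<E> i. \<forall>L\<in>\<E> j. \<forall>s\<in>K \<inter> L. \<forall>t\<in>K \<inter> L.
      s \<noteq> t \<longrightarrow> {s, t} = {({}, {}, {}), ({1..m}, {1..n}, {1..p})}))"
proof -
  have dim: "4 \<le> m" "4 \<le> n" "4 \<le> p"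
    using dimension_ge_4[OF assms(1,4,5)] dimension_ge_4[OF assms(2,4,6)] dimension_ge_4[OF assms(3,4,7)] .
  obtain D where D: "\<forall>i\<in>{1..k}. \<forall>A\<in>\<F> i. card A \<le> 2 \<longrightarrow> A \<inter> D i \<noteq> {}"
    "\<forall>i\<in>{1..k}. \<forall>j\<in>{1..k}. i \<noteq> j \<longrightarrow> D i \<inter> D j = {}"
    using good_designated[OF assms(8,5)] by blast
  obtain D' where D': "\<forall>i\<in>{1..k}. \<forall>A\<in>\<G> i. card A \<le> 2 \<longrightarrow> A \<inter> D' i \<noteq> {}"
    "\<forall>i\<in>{1..k}. \<forall>j\<in>{1..k}. i \<noteq> j \<longrightarrow> D' i \<inter> D' j = {}"
    using good_designated[OF assms(9,6)] by blast
  obtain D'' where D'': "\<forall>i\<in>{1..k}. \<forall>A\<in>\<H> i. card A = 1 \<longrightarrow> A \<subseteq> D'' i"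
    "\<forall>i\<in>{1..k}. \<forall>j\<in>{1..k}. i \<noteq> j \<longrightarrow> D'' i \<inter> D'' j = {}"
    using good_singletons[OF assms(3,10)] by blast
  let ?Q = "Pow {1..m} \<times> Pow {1..n} \<times> Pow {1..p}"
  let ?P = "\<lambda>i K. cube_tame m n p (D i) (D' i) (D'' i) K \<and> (\<exists>A\<in>\<F> i. \<exists>B\<in>\<G> i. \<exists>C\<in>\<H> i. K \<subseteq> A \<times> B \<times> C)"
  have scd: "scd m (\<F> i)" "scd n (\<G> i)" "scd p (\<H> i)" if "i \<in> {1..k}" for i
    using assms(1-3) that by (auto simp: almost_orthogonal_scds_def)
  have "has_scd le3 card3 (m + n + p) (?P i) ?Q" if i: "i \<in> {1..k}" for i
  proof -
    \<comment> \<open>The cuboids over all triples of chains with the same \<open>i\<close>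
      partition the product, so their decompositions can be glued.\<close>
    let ?I = "\<F> i \<times> \<G> i \<times> \<H> i" and ?G = "\<lambda>(A, B, C). A \<times> B \<times> C"
    have "has_scd le3 card3 (m + n + p) (?P i) (\<Union>a\<in>?I. ?G a)"
    proof (rule has_scd_Union)
      fix a assume "a \<in> ?I"
      then obtain A B C where a: "a = (A, B, C)" "A \<in> \<F> i" "B \<in> \<G> i" "C \<in> \<H> i" by auto
      have "has_scd le3 card3 (m + n + p) (cube_tame m n p (D i) (D' i) (D'' i)) (A \<times> B \<times> C)"
        by (rule has_scd_cuboid[OF dim scdD(1)[OF scd(1)[OF i] a(2)] scdD(1)[OF scd(2)[OF i] a(3)]
              scdD(1)[OF scd(3)[OF i] a(4)]])
          (use D(1) D'(1) D''(1) i a in blast)+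
      then have "has_scd le3 card3 (m + n + p) (?P i) (A \<times> B \<times> C)"
        by (rule has_scd_mono[OF has_scd_subset]) (use a in blast)
      then show "has_scd le3 card3 (m + n + p) (?P i) (?G a)" using a(1) by simp
    next
      have disj: "disjoint (\<F> i)" "disjoint (\<G> i)" "disjoint (\<H> i)"
        using scd[OF i] by (auto simp: scd_def partition_on_def)
      show "disjoint_family_on ?G ?I"
        unfolding disjoint_family_on_def
      proof (intro ballI impI)
        fix a b assume ab: "a \<in> ?I" "b \<in> ?I" "a \<noteq> b"
        obtain A B C where a: "a = (A, B, C)" "A \<in> \<F> i" "B \<in> \<G> i" "C \<in> \<H> i" using ab(1) by auto
        obtain A' B' C' where b: "b = (A', B', C')" "A' \<in> \<F> i" "B' \<in> \<G> i" "C' \<in> \<H> i" using ab(2) by auto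
        have "A \<noteq> A' \<or> B \<noteq> B' \<or> C \<noteq> C'" using ab(3) a(1) b(1) by simp
        then have "A \<inter> A' = {} \<or> B \<inter> B' = {} \<or> C \<inter> C' = {}"
          using disjointD[OF disj(1) a(2) b(2)] disjointD[OF disj(2) a(3) b(3)] disjointD[OF disj(3) a(4) b(4)] by blast
        then show "?G a \<inter> ?G b = {}" using a(1) b(1) by auto
      qed
    qed
    also have "(\<Union>a\<in>?I. ?G a) = \<Union>(\<F> i) \<times> \<Union>(\<G> i) \<times> \<Union>(\<H> i)" by auto
    also have "\<dots> = ?Q" using scd[OF i] by (simp add: scd_def partition_on_def)
    finally show ?thesis .
  qed
  then have "\<forall>i\<in>{1..k}. \<exists>E. partition_on ?Q E \<and> (\<forall>K\<in>E. symch le3 card3 (m + n + p) K \<and> ?P i K)"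
    unfolding has_scd_def by blast
  from bchoice[OF this] obtain \<E> where E: "\<forall>i\<in>{1..k}. partition_on ?Q (\<E> i) \<and>
      (\<forall>K\<in>\<E> i. symch le3 card3 (m + n + p) K \<and> ?P i K)" by blast
  have ordered: "s = ({}, {}, {}) \<and> t = ({1..m}, {1..n}, {1..p})"
    if ij: "i \<in> {1..k}" "j \<in> {1..k}" "i \<noteq> j" and KL: "K \<in> \<E> i" "L \<in> \<E> j"
      and st: "s \<in> K" "s \<in> L" "t \<in> K" "t \<in> L" "s \<noteq> t" "le3 s t" for i j K L s t
  proof -
    obtain A B C where A: "A \<in> \<F> i" "B \<in> \<G> i" "C \<in> \<H> i" "K \<subseteq> A \<times> B \<times> C" using E ij(1) KL(1) by blast
    obtain A' B' C' where A': "A' \<in> \<F> j" "B' \<in> \<G> j" "C' \<in> \<H> j" "L \<subseteq> A' \<times> B' \<times> C'" using E ij(2) KL(2) by blast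
    obtain x y z where s: "s = (x, y, z)" by (cases s)
    obtain x' y' z' where t: "t = (x', y', z')" by (cases t)
    have orth: "almost_orthogonal m (\<F> i) (\<F> j)" "almost_orthogonal n (\<G> i) (\<G> j)" "almost_orthogonal p (\<H> i) (\<H> j)"
      using assms(1-3) ij by (auto simp: almost_orthogonal_scds_def pairwise_def)
    have mem: "x \<in> A" "x' \<in> A" "x \<in> A'" "x' \<in> A'" "y \<in> B" "y' \<in> B" "y \<in> B'" "y' \<in> B'"
      "z \<in> C" "z' \<in> C" "z \<in> C'" "z' \<in> C'" using st(1-4) A(4) A'(4) s t by auto
    have le: "x \<subseteq> x'" "y \<subseteq> y'" "z \<subseteq> z'" using st(6) s t by (auto simp: le3_def)
    have pos: "0 < m" "0 < n" "0 < p" using dim by auto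
    have jumps: "x = x' \<or> top_jump m x x'" "y = y' \<or> top_jump n y y'" "z = z' \<or> top_jump p z z'"
      using top_jump_of_meet[OF orth(1) scd(1)[OF ij(1)] A(1) A'(1) pos(1) mem(1-4) le(1)]
        top_jump_of_meet[OF orth(2) scd(2)[OF ij(1)] A(2) A'(2) pos(2) mem(5-8) le(2)]
        top_jump_of_meet[OF orth(3) scd(3)[OF ij(1)] A(3) A'(3) pos(3) mem(9-12) le(3)] .
    have "cube_tame m n p (D i) (D' i) (D'' i) K" "cube_tame m n p (D j) (D' j) (D'' j) L"
      using E ij KL by blast+
    note tame = this(1)[unfolded cube_tame_def, rule_format, OF st(1,3)[unfolded s t]]
      this(2)[unfolded cube_tame_def, rule_format, OF st(2,4)[unfolded s t]]
    \<comment> \<open>A bad pattern would place the same constant coordinate in the designated sets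
      for both \<open>i\<close> and \<open>j\<close>, which are disjoint.\<close>
    have "\<not> (x \<in> D i \<and> x \<in> D j)" "\<not> (y \<in> D' i \<and> y \<in> D' j)" "\<not> (z \<in> D'' i \<and> z \<in> D'' j)"
      using D(2) D'(2) D''(2) ij by blast+
    moreover have "x \<noteq> x' \<or> y \<noteq> y' \<or> z \<noteq> z'" using st(5) s t by simp
    ultimately have "top_jump m x x' \<and> top_jump n y y' \<and> top_jump p z z'"
      using jumps tame by argo
    then show ?thesis using s t by (simp add: top_jump_def)
  qed
  have meet: "{s, t} = {({}, {}, {}), ({1..m}, {1..n}, {1..p})}"
    if ij: "i \<in> {1..k}" "j \<in> {1..k}" "i \<noteq> j" and KL: "K \<in> \<E> i" "L \<in> \<E> j"
      and st: "s \<in> K \<inter> L" "t \<in> K \<inter> L" "s \<noteq> t" for i j K L s t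
  proof -
    have "symch le3 card3 (m + n + p) K" using E ij KL by blast
    then have "le3 s t \<or> le3 t s" by (rule symch_comparable) (use st in auto)
    then show ?thesis
    proof
      assume "le3 s t"
      then have "s = ({}, {}, {}) \<and> t = ({1..m}, {1..n}, {1..p})" using ordered[OF ij KL, of s t] st by blast
      then show ?thesis by simp
    next
      assume "le3 t s"
      then have "t = ({}, {}, {}) \<and> s = ({1..m}, {1..n}, {1..p})" using ordered[OF ij KL, of t s] st by blast
      then show ?thesis by (simp add: insert_commute)
    qed
  qed
  show ?thesis
  proof (intro exI[of _ \<E>] conjI ballI impI)
    fix i j K L s t assume "i \<in> {1..k}" "j \<in> {1..k}" "i \<noteq> j" "K \<in> \<E> i" "L \<in> \<E> j"
      "s \<in> K \<inter> L" "t \<in> K \<inter> L" "s \<noteq> t"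
    then show "{s, t} = {({}, {}, {}), ({1..m}, {1..n}, {1..p})}" by (rule meet)
  qed (use E in blast)+
qed

section \<open>Transport to the cube\<close>

lemma symch_imp_symmetric_chain:
  assumes "symch (\<subseteq>) card N K" "K \<subseteq> Pow {1..N}"
  shows "symmetric_chain N K"
proof -
  obtain j f where f: "2 * j \<le> N" "K = f ` {j..N - j}" "\<forall>r\<in>{j..N - j}. card (f r) = r"
    using assms(1) unfolding symch_def by blast
  have "bij_betw card K {j..N - j}"
    by (rule bij_betw_byWitness[where f' = f]) (use f(2,3) in auto)
  moreover have "subset.chain (Pow {1..N}) K"
    unfolding subset.chain_def using assms(2) symch_comparable[OF assms(1)] by blast
  moreover have "j \<le> N - j" using f(1) by linarith
  ultimately show ?thesis unfolding symmetric_chain_def by blast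
qed

text \<open>Since \<open>g\<close> preserves size, it sends bottom and top to \<open>{}\<close> and
  \<open>{1..N}\<close>; by injectivity, pairs shared by images come from shared pairs.\<close>

lemma almost_orthogonal_scds_transport:
  assumes "\<forall>i\<in>{1..k}. partition_on (Pow {1..m} \<times> Pow {1..n} \<times> Pow {1..p}) (\<E> i) \<and>
      (\<forall>K\<in>\<E> i. symch le3 card3 (m + n + p) K)"
    and "\<forall>i\<in>{1..k}. \<forall>j\<in>{1..k}. i \<noteq> j \<longrightarrow> (\<forall>K\<in>\<E> i. \<forall>L\<in>\<E> j. \<forall>s\<in>K \<inter> L. \<forall>t\<in>K \<inter> L.
      s \<noteq> t \<longrightarrow> {s, t} = {({}, {}, {}), ({1..m}, {1..n}, {1..p})})"
    and bij: "bij_betw g (Pow {1..m} \<times> Pow {1..n} \<times> Pow {1..p}) (Pow {1..N})"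
    and N: "N = m + n + p" "0 < N"
    and card: "\<And>q. q \<in> Pow {1..m} \<times> Pow {1..n} \<times> Pow {1..p} \<Longrightarrow> card (g q) = card3 q"
    and mono: "\<And>q q'. q \<in> Pow {1..m} \<times> Pow {1..n} \<times> Pow {1..p} \<Longrightarrow>
      q' \<in> Pow {1..m} \<times> Pow {1..n} \<times> Pow {1..p} \<Longrightarrow> le3 q q' \<Longrightarrow> g q \<subseteq> g q'"
  shows "almost_orthogonal_scds N k (\<lambda>i. (`) g ` \<E> i)"
proof -
  let ?Q = "Pow {1..m} \<times> Pow {1..n} \<times> Pow {1..p}"
  have inj: "inj_on g ?Q" and im: "g ` ?Q = Pow {1..N}" using bij by (auto simp: bij_betw_def)
  have sub: "K \<subseteq> ?Q" if "i \<in> {1..k}" "K \<in> \<E> i" for i K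
  proof -
    have "\<Union>(\<E> i) = ?Q" using assms(1) that(1) by (simp add: partition_on_def)
    then show ?thesis using that(2) by blast
  qed
  have "scd N ((`) g ` \<E> i)" if i: "i \<in> {1..k}" for i
    unfolding scd_def
  proof
    have part: "partition_on ?Q (\<E> i)" using assms(1) i by blast
    have "{} \<notin> (`) g ` \<E> i" using partition_onD3[OF part] by auto
    then show "partition_on (Pow {1..N}) ((`) g ` \<E> i)"
      using partition_on_inj_image[OF part inj] unfolding im by simp
    show "\<forall>C\<in>(`) g ` \<E> i. symmetric_chain N C"
    proof
      fix C assume "C \<in> (`) g ` \<E> i"
      then obtain K where K: "K \<in> \<E> i" "C = g ` K" by blast
      have s: "symch le3 card3 (m + n + p) K" using assms(1) i K(1) by blast
      have "symch (\<subseteq>) card N (g ` K)"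
      proof (rule symch_image[OF s, where j = 0])
        show "card (g x) = 0 + card3 x" if "x \<in> K" for x using card sub[OF i K(1)] that by auto
        show "N = m + n + p + 2 * 0" using N(1) by simp
        show "g x \<subseteq> g y" if "x \<in> K" "y \<in> K" "le3 x y" for x y
          by (rule mono) (use that sub[OF i K(1)] in blast)+
      qed
      moreover have "g ` K \<subseteq> Pow {1..N}" using sub[OF i K(1)] im by blast
      ultimately show "symmetric_chain N C" unfolding K(2) by (rule symch_imp_symmetric_chain)
    qed
  qed
  moreover have "almost_orthogonal N ((`) g ` \<E> i) ((`) g ` \<E> j)"
    if ij: "i \<in> {1..k}" "j \<in> {1..k}" "i \<noteq> j" for i j
    unfolding almost_orthogonal_def
  proof (intro ballI)
    fix A B assume "A \<in> (`) g ` \<E> i" "B \<in> (`) g ` \<E> j"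
    then obtain K L where K: "K \<in> \<E> i" "A = g ` K" and L: "L \<in> \<E> j" "B = g ` L" by blast
    have bot: "({}, {}, {}) \<in> ?Q" and top: "({1..m}, {1..n}, {1..p}) \<in> ?Q" by auto
    have range: "g ({}, {}, {}) \<subseteq> {1..N}" "g ({1..m}, {1..n}, {1..p}) \<subseteq> {1..N}" using im bot top by blast+
    have "card (g ({}, {}, {})) = 0" "card (g ({1..m}, {1..n}, {1..p})) = card {1..N}"
      using card[OF bot] card[OF top] N(1) by (simp_all add: card3_def)
    then have ends: "g ({}, {}, {}) = {}" "g ({1..m}, {1..n}, {1..p}) = {1..N}"
      using finite_subset[OF range(1)] card_subset_eq[OF finite_atLeastAtMost range(2)]
      by (auto simp: card_eq_0_iff)
    have two: "{x, y} = {{}, {1..N}}" if xy: "x \<in> A \<inter> B" "y \<in> A \<inter> B" "x \<noteq> y" for x y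
    proof -
      have "A \<inter> B = g ` (K \<inter> L)"
        unfolding K(2) L(2) using inj_on_image_Int[OF inj sub[OF ij(1) K(1)] sub[OF ij(2) L(1)]] by simp
      with xy(1,2) have "x \<in> g ` (K \<inter> L)" "y \<in> g ` (K \<inter> L)" by (simp_all only:)
      then obtain s t where st: "s \<in> K \<inter> L" "t \<in> K \<inter> L" "x = g s" "y = g t" by (elim imageE)
      then have "s \<noteq> t" using xy(3) by blast
      then have "{s, t} = {({}, {}, {}), ({1..m}, {1..n}, {1..p})}"
        by (rule assms(2)[rule_format, OF ij K(1) L(1) st(1,2)])
      then have "g ` {s, t} = g ` {({}, {}, {}), ({1..m}, {1..n}, {1..p})}" by (rule arg_cong)
      then show ?thesis using ends st(3,4) by simp
    qed
    show "if {{}, {1..N}} \<subseteq> A \<and> {{}, {1..N}} \<subseteq> B then card (A \<inter> B) = 2 else card (A \<inter> B) \<le> 1"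
    proof (cases "{{}, {1..N}} \<subseteq> A \<and> {{}, {1..N}} \<subseteq> B")
      case True
      have "A \<inter> B \<subseteq> {{}, {1..N}}"
      proof
        fix x assume x: "x \<in> A \<inter> B"
        show "x \<in> {{}, {1..N}}"
        proof (cases "x = {}")
          case False
          then have "{x, {}} = {{}, {1..N}}" using two[OF x, of "{}"] True by blast
          then show ?thesis by blast
        qed simp
      qed
      then have "A \<inter> B = {{}, {1..N}}" using True by blast
      moreover have "card {{}, {1..N}} = 2" using N(2) by auto
      ultimately show ?thesis using True by simp
    next
      case False
      have "x = y" if "x \<in> A \<inter> B" "y \<in> A \<inter> B" for x y
      proof (rule ccontr)
        assume "x \<noteq> y"
        moreover have "{x, y} \<subseteq> A" "{x, y} \<subseteq> B" using that by simp_all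
        ultimately show False using False unfolding two[OF that \<open>x \<noteq> y\<close>] by simp
      qed
      \<comment> \<open>In the infinite case \<open>card\<close> is 0 by default.\<close>
      then have "card (A \<inter> B) \<le> 1"
        by (cases "finite (A \<inter> B)") (auto simp: card_le_Suc0_iff_eq)
      then show ?thesis using False by simp
    qed
  qed
  ultimately show ?thesis unfolding almost_orthogonal_scds_def pairwise_def by simp
qed

lemma card_cube_prod:
  assumes "X \<subseteq> {1..m}" "Y \<subseteq> {1..n}" "Z \<subseteq> {1..p}"
  shows "card (cube_prod m n (X, Y, Z)) = card X + card Y + card Z"
proof -
  have fin: "finite X" "finite Y" "finite Z" using assms finite_subset by blast+
  have "X \<inter> (+) m ` Y = {}" "(X \<union> (+) m ` Y) \<inter> (+) (m + n) ` Z = {}"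
    using assms by fastforce+
  then have "card (X \<union> (+) m ` Y \<union> (+) (m + n) ` Z) = card X + card ((+) m ` Y) + card ((+) (m + n) ` Z)"
    using fin by (simp add: card_Un_disjoint)
  then show ?thesis by (simp add: cube_prod_def card_image)
qed

text \<open>The identification \<open>g\<close> is left open so that the factors can be listed in
  any order, with the family that may fail to be good in third place.\<close>

lemma almost_orthogonal_cuboids:
  assumes "almost_orthogonal_scds a k \<F>" "almost_orthogonal_scds b k \<G>" "almost_orthogonal_scds c k \<H>"
    and "3 \<le> k" "2 \<le> a" "2 \<le> b" "2 \<le> c"
    and "good a k \<F>" "good b k \<G>" "good c k \<H> \<or> odd c"
    and N: "N = a + b + c"
    and g: "bij_betw g (Pow {1..a} \<times> Pow {1..b} \<times> Pow {1..c}) (Pow {1..N})"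
      "\<And>q. q \<in> Pow {1..a} \<times> Pow {1..b} \<times> Pow {1..c} \<Longrightarrow> card (g q) = card3 q"
      "\<And>q q'. q \<in> Pow {1..a} \<times> Pow {1..b} \<times> Pow {1..c} \<Longrightarrow>
        q' \<in> Pow {1..a} \<times> Pow {1..b} \<times> Pow {1..c} \<Longrightarrow> le3 q q' \<Longrightarrow> g q \<subseteq> g q'"
  shows "\<exists>\<D>. almost_orthogonal_scds N k \<D> \<and>
    (\<forall>i\<in>{1..k}. \<forall>S\<in>\<D> i. \<exists>A\<in>\<F> i. \<exists>B\<in>\<G> i. \<exists>C\<in>\<H> i. S \<subseteq> g ` (A \<times> B \<times> C))"
proof -
  obtain \<E> where E: "\<forall>i\<in>{1..k}. partition_on (Pow {1..a} \<times> Pow {1..b} \<times> Pow {1..c}) (\<E> i) \<and>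
      (\<forall>K\<in>\<E> i. symch le3 card3 (a + b + c) K \<and> (\<exists>A\<in>\<F> i. \<exists>B\<in>\<G> i. \<exists>C\<in>\<H> i. K \<subseteq> A \<times> B \<times> C))"
    "\<forall>i\<in>{1..k}. \<forall>j\<in>{1..k}. i \<noteq> j \<longrightarrow> (\<forall>K\<in>\<E> i. \<forall>L\<in>\<E> j. \<forall>s\<in>K \<inter> L. \<forall>t\<in>K \<inter> L.
      s \<noteq> t \<longrightarrow> {s, t} = {({}, {}, {}), ({1..a}, {1..b}, {1..c})})"
    using almost_orthogonal_product[OF assms(1-10)] by (elim exE conjE)
  have "almost_orthogonal_scds N k (\<lambda>i. (`) g ` \<E> i)"
    by (rule almost_orthogonal_scds_transport[OF _ E(2) g(1) N _ g(2,3)]) (use E(1) N assms(5) in auto)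
  moreover have "\<exists>A\<in>\<F> i. \<exists>B\<in>\<G> i. \<exists>C\<in>\<H> i. S \<subseteq> g ` (A \<times> B \<times> C)" if i: "i \<in> {1..k}" "S \<in> (`) g ` \<E> i" for i S
  proof -
    obtain K where K: "K \<in> \<E> i" "S = g ` K" using i(2) by blast
    obtain A B C where "A \<in> \<F> i" "B \<in> \<G> i" "C \<in> \<H> i" "K \<subseteq> A \<times> B \<times> C" using E(1) i(1) K(1) by blast
    then show ?thesis using image_mono K(2) by blast
  qed
  ultimately show ?thesis by blast
qed

theorem theorem6p1:
  fixes m n p k :: nat
    and \<F> \<G> \<H> :: "nat \<Rightarrow> nat set set set"
  assumes "m \<ge> 2" and "n \<ge> 2" and "p \<ge> 2" and "k \<ge> 3"
    and "almost_orthogonal_scds m k \<F>"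
    and "almost_orthogonal_scds n k \<G>"
    and "almost_orthogonal_scds p k \<H>"
    and "good m k \<F> \<and> good n k \<G> \<and> (good p k \<H> \<or> odd p) \<or>
         good m k \<F> \<and> good p k \<H> \<and> (good n k \<G> \<or> odd n) \<or>
         good n k \<G> \<and> good p k \<H> \<and> (good m k \<F> \<or> odd m)"
  shows "\<exists>\<D>. almost_orthogonal_scds (m + n + p) k \<D> \<and>
           (\<forall>i\<in>{1..k}. \<forall>S\<in>\<D> i. \<exists>A\<in>\<F> i. \<exists>B\<in>\<G> i. \<exists>C\<in>\<H> i. S \<subseteq> cuboid m n A B C)"
proof -
  let ?N = "m + n + p"
  have mono: "cube_prod m n q \<subseteq> cube_prod m n q'" if "le3 q q'" for q q'
    using that unfolding cube_prod_def le3_def by auto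
  consider (H) "good m k \<F>" "good n k \<G>" "good p k \<H> \<or> odd p"
    | (G) "good m k \<F>" "good p k \<H>" "good n k \<G> \<or> odd n"
    | (F) "good n k \<G>" "good p k \<H>" "good m k \<F> \<or> odd m"
    using assms(8) by blast
  then show ?thesis
  proof cases
    case H
    show ?thesis
      unfolding cuboid_def
      by (rule almost_orthogonal_cuboids[OF assms(5-7,4,1-3) H refl bij_betw_cube_prod])
        (auto simp: card_cube_prod card3_def dest!: mono)
  next
    case G
    \<comment> \<open>The second factor is listed last, and \<open>?r\<close> restores the
      order.\<close>
    let ?r = "\<lambda>(x, z, y). (x, y, z)"
    have "bij_betw ?r (Pow {1..m} \<times> Pow {1..p} \<times> Pow {1..n}) (Pow {1..m} \<times> Pow {1..n} \<times> Pow {1..p})"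
      by (rule bij_betw_byWitness[where f' = "\<lambda>(x, y, z). (x, z, y)"]) auto
    from bij_betw_trans[OF this bij_betw_cube_prod]
    have bij: "bij_betw (cube_prod m n \<circ> ?r) (Pow {1..m} \<times> Pow {1..p} \<times> Pow {1..n}) (Pow {1..?N})" .
    have comp_mono: "(cube_prod m n \<circ> ?r) q \<subseteq> (cube_prod m n \<circ> ?r) q'" if "le3 q q'" for q q'
      using mono[of "?r q" "?r q'"] that by (cases q, cases q') (simp add: le3_def)
    have img: "(cube_prod m n \<circ> ?r) ` (A \<times> C \<times> B) = cuboid m n A B C" for A B C
      unfolding cuboid_def image_comp[symmetric] by (rule arg_cong[where f = "image _"]) force
    have "\<exists>\<D>. almost_orthogonal_scds ?N k \<D> \<and> (\<forall>i\<in>{1..k}. \<forall>S\<in>\<D> i.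
        \<exists>A\<in>\<F> i. \<exists>C\<in>\<H> i. \<exists>B\<in>\<G> i. S \<subseteq> (cube_prod m n \<circ> ?r) ` (A \<times> C \<times> B))"
      by (rule almost_orthogonal_cuboids[OF assms(5,7,6,4,1,3,2) G _ bij])
        (use comp_mono in \<open>auto simp: card_cube_prod card3_def\<close>)
    then obtain \<D> where D: "almost_orthogonal_scds ?N k \<D>"
      "\<forall>i\<in>{1..k}. \<forall>S\<in>\<D> i. \<exists>A\<in>\<F> i. \<exists>C\<in>\<H> i. \<exists>B\<in>\<G> i. S \<subseteq> cuboid m n A B C"
      unfolding img by (elim exE conjE)
    have "\<exists>A\<in>\<F> i. \<exists>B\<in>\<G> i. \<exists>C\<in>\<H> i. S \<subseteq> cuboid m n A B C"
      if "i \<in> {1..k}" "S \<in> \<D> i" for i S using bspec[OF bspec[OF D(2) that(1)] that(2)] by blast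
    then show ?thesis using D(1) by (intro exI[of _ \<D>]) simp
  next
    case F
    \<comment> \<open>Now the first factor is listed last.\<close>
    let ?r = "\<lambda>(y, z, x). (x, y, z)"
    have "bij_betw ?r (Pow {1..n} \<times> Pow {1..p} \<times> Pow {1..m}) (Pow {1..m} \<times> Pow {1..n} \<times> Pow {1..p})"
      by (rule bij_betw_byWitness[where f' = "\<lambda>(x, y, z). (y, z, x)"]) auto
    from bij_betw_trans[OF this bij_betw_cube_prod]
    have bij: "bij_betw (cube_prod m n \<circ> ?r) (Pow {1..n} \<times> Pow {1..p} \<times> Pow {1..m}) (Pow {1..?N})" .
    have comp_mono: "(cube_prod m n \<circ> ?r) q \<subseteq> (cube_prod m n \<circ> ?r) q'" if "le3 q q'" for q q'
      using mono[of "?r q" "?r q'"] that by (cases q, cases q') (simp add: le3_def)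
    have img: "(cube_prod m n \<circ> ?r) ` (B \<times> C \<times> A) = cuboid m n A B C" for A B C
      unfolding cuboid_def image_comp[symmetric] by (rule arg_cong[where f = "image _"]) force
    have "\<exists>\<D>. almost_orthogonal_scds ?N k \<D> \<and> (\<forall>i\<in>{1..k}. \<forall>S\<in>\<D> i.
        \<exists>B\<in>\<G> i. \<exists>C\<in>\<H> i. \<exists>A\<in>\<F> i. S \<subseteq> (cube_prod m n \<circ> ?r) ` (B \<times> C \<times> A))"
      by (rule almost_orthogonal_cuboids[OF assms(6,7,5,4,2,3,1) F _ bij])
        (use comp_mono in \<open>auto simp: card_cube_prod card3_def\<close>)
    then obtain \<D> where D: "almost_orthogonal_scds ?N k \<D>"
      "\<forall>i\<in>{1..k}. \<forall>S\<in>\<D> i. \<exists>B\<in>\<G> i. \<exists>C\<in>\<H> i. \<exists>A\<in>\<F> i. S \<subseteq> cuboid m n A B C"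
      unfolding img by (elim exE conjE)
    have "\<exists>A\<in>\<F> i. \<exists>B\<in>\<G> i. \<exists>C\<in>\<H> i. S \<subseteq> cuboid m n A B C"
      if "i \<in> {1..k}" "S \<in> \<D> i" for i S using bspec[OF bspec[OF D(2) that(1)] that(2)] by blast
    then show ?thesis using D(1) by (intro exI[of _ \<D>]) simp
  qed
qed

end
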